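(* Let $D\subset\mathbb{C}$ be open, simply connected and contain $0$. Let $\tilde N:D\to S^2$ be a non-conformal harmonic map with lift $\tilde F=\tilde F(\theta):D\to\Lambda\mathrm{SU}(2)$, and let $\tilde\Omega(\theta)=\tilde F^{-1}d\tilde F=\tilde\Omega_1'+\tilde\Omega_0+\tilde\Omega_1''$, where $\tilde\Omega_0$ is the diagonal part and $\tilde\Omega_1'$, $\tilde\Omega_1''$ are the $(1,0)$- and $(0,1)$-parts of the off-diagonal part. Let $a>0$ be an arbitrary real constant, and let $$\beta_1'(a)=\tfrac14(a-1)(\sigma_0-\sigma_3)\,\tilde\Omega_1'\,(\sigma_0+\sigma_3),\qquad \beta_1''(a)=\tfrac14(a^{-1}-1)(\sigma_0+\sigma_3)\,\tilde\Omega_1''\,(\sigma_0-\sigma_3),$$ $$\Omega=\Omega(a,\theta):=\tilde\Omega(\theta)+\beta_1'(a)+\beta_1''(a).$$ Then: (i) $d\Omega(a,\theta)+\frac12[\Omega(a,\theta)\wedge\Omega(a,\theta)]=0$. (ii) If $F$ is an $\mathrm{SL}(2,\mathbb{C})$-valued solution of $\Omega=F^{-1}dF$, then $f=F\cdot F^*$ is a conformal immersion (into $\mathbb{H}^3$) with isolated singularities and constant mean curvature $H=\dfrac{a^2+1}{a^2-1}$.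
   Context: $\sigma_0=I$ and $\sigma_3=\mathrm{diag}(1,-1)$; $F^*=\overline F^{\,t}$. $\mathbb{R}^{3,1}$ is identified with the $2\times2$ Hermitian matrices via $(x^0,x^1,x^2,x^3)\mapsto\begin{pmatrix} x^0+x^3 & x^1+ix^2 \\ x^1-ix^2 & x^0-x^3 \end{pmatrix}$, so that $\langle X,X\rangle=-\det X$; hyperbolic 3-space $\mathbb{H}^3$ (curvature $-1$) is the set of positive definite Hermitian matrices of determinant $1$, and $\mathrm{SL}(2,\mathbb{C})$ acts on it isometrically by $g\cdot h=ghg^*$. For a conformal immersion $f$ with metric $e^{2u}dz\,d\bar z$ and unit normal field $N$, the mean curvature $H$ is determined by $\langle f_{z\bar z},N\rangle=\frac12He^{2u}$. The unit normal used is $N=e_3=\hat F\sigma_3\hat F^*$, where $\hat F$ is the moving frame of the immersion; the frames $F$ whose Maurer–Cartan form is written in the form used in the claim are related to moving frames by conjugation, $F=\mathcal G\hat F\mathcal G^{-1}$ with the unitary matrix $\mathcal G=i\begin{pmatrix}0&\theta^{1/2}\\ \theta^{-1/2}&0\end{pmatrix}$, so that in terms of $F$ the normal is $-F\sigma_3F^*$. $\Lambda\mathrm{SU}(2)$ is the group of loops $g:S^1\to\mathrm{SU}(2)$ with $g(-\theta)=\sigma_3g(\theta)\sigma_3^{-1}$. $S^2=\mathrm{SU}(2)/\mathrm{U}(1)$, with $\mathrm{U}(1)$ the diagonal subgroup. The lift $\tilde F(\theta)$ of a harmonic map $\tilde N$ is its extended frame: a family of maps $\tilde F(\cdot,\theta):D\to\mathrm{SU}(2)$,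 $\theta\in S^1$, with $\tilde F(\cdot,1)$ projecting to $\tilde N$, such that $\tilde F^{-1}d\tilde F=\theta^{-1}\alpha_1'+\alpha_0+\theta\alpha_1''$, where $\alpha_0$ is a diagonal 1-form and $\alpha_1'$, $\alpha_1''$ are off-diagonal matrix-valued forms of type $(1,0)$ and $(0,1)$ respectively, all independent of $\theta$; thus $\tilde\Omega_1'=\theta^{-1}\alpha_1'$, $\tilde\Omega_0=\alpha_0$, $\tilde\Omega_1''=\theta\alpha_1''$. A harmonic map $\tilde N$ is non-conformal if its Hopf differential $\langle\tilde N_z,\tilde N_z\rangle dz^2$ is not identically zero.
   Formalization: Part (ii) is stated for a > 0 with a ≠ 1: at a = 1 one has Ω = Ω̃, so f = F·F* is constant, every point is singular, and H = (a²+1)/(a²−1) is undefined. *)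

theory Defs
  imports "HOL-Analysis.Analysis"
begin

section \<open>Matrices\<close>

type_synonym cmat = "complex^2^2"

definition \<sigma>0 :: cmat where "\<sigma>0 = mat 1"

definition \<sigma>3 :: cmat where "\<sigma>3 = vector [vector [1, 0], vector [0, -1]]"

definition ctranspose :: "cmat \<Rightarrow> cmat"
  where "ctranspose A = map_matrix cnj (transpose A)"

definition cscale :: "complex \<Rightarrow> cmat \<Rightarrow> cmat"
  where "cscale c A = map_matrix (\<lambda>x. c * x) A"

definition commutator :: "cmat \<Rightarrow> cmat \<Rightarrow> cmat"
  where "commutator A B = A ** B - B ** A"

definition diag_part :: "cmat \<Rightarrow> cmat"
  where "diag_part A = (\<chi> i j. if i = j then A $ i $ j else 0)"

definition offdiag_part :: "cmat \<Rightarrow> cmat"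
  where "offdiag_part A = (\<chi> i j. if i = j then 0 else A $ i $ j)"

definition hermitian :: "cmat \<Rightarrow> bool"
  where "hermitian A \<longleftrightarrow> ctranspose A = A"

definition SL2C :: "cmat set"
  where "SL2C = {A. det A = 1}"

definition SU2 :: "cmat set"
  where "SU2 = {A. A ** ctranspose A = mat 1 \<and> det A = 1}"

definition LambdaSU2 :: "(complex \<Rightarrow> cmat) set"
  where "LambdaSU2 = {g. continuous_on (sphere 0 1) g \<and>
    (\<forall>\<theta>\<in>sphere 0 1. g \<theta> \<in> SU2 \<and> g (- \<theta>) = \<sigma>3 ** g \<theta> ** matrix_inv \<sigma>3)}"


section \<open>Minkowski space, hyperbolic 3-space and the 2-sphere\<close>

text \<open>The polarization of \<open>- det\<close>.  It is bilinear over the complex numbers; on Hermitian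
  matrices it is the Minkowski inner product, and on all matrices it is the complex bilinear
  extension of that inner product, the complexification of the Hermitian matrices being the
  space of all matrices with \<open>\<i>\<close> acting by \<open>cscale \<i>\<close>.\<close>

definition mink :: "cmat \<Rightarrow> cmat \<Rightarrow> complex"
  where "mink X Y = - (det (X + Y) - det X - det Y) / 2"

lemma mink_self: "mink X X = - det X"
  by (simp add: mink_def det_2 field_simps)

lemma mink_self_coordinates:
  fixes x0 x1 x2 x3 :: real
  shows "mink (vector [vector [x0 + x3, x1 + \<i> * x2], vector [x1 - \<i> * x2, x0 - x3]])
              (vector [vector [x0 + x3, x1 + \<i> * x2], vector [x1 - \<i> * x2, x0 - x3]])
         = complex_of_real (- x0\<^sup>2 + x1\<^sup>2 + x2\<^sup>2 + x3\<^sup>2)"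
  unfolding mink_self by (simp add: det_2 algebra_simps power2_eq_square)

definition H3 :: "cmat set"
  where "H3 = {X. hermitian X \<and> det X = 1 \<and>
    (\<forall>v. v \<noteq> 0 \<longrightarrow> 0 < Re (\<Sum>i\<in>UNIV. \<Sum>j\<in>UNIV. cnj (v $ i) * X $ i $ j * v $ j))}"

text \<open>\<open>SU(2)/U(1)\<close> is realized as the orbit of \<open>\<sigma>3\<close> under conjugation, that is, as the unit
  sphere of the Euclidean 3-space of traceless Hermitian matrices with inner product \<open>mink\<close>.\<close>

definition S2_proj :: "cmat \<Rightarrow> cmat"
  where "S2_proj g = g ** \<sigma>3 ** matrix_inv g"

definition S2 :: "cmat set"
  where "S2 = S2_proj ` SU2"

lemma SU2_inv:
  assumes "g \<in> SU2"
  shows "matrix_inv g = ctranspose g" "g ** matrix_inv g = mat 1" "matrix_inv g ** g = mat 1"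
proof -
  have 1: "g ** ctranspose g = mat 1" using assms by (simp add: SU2_def)
  then have 2: "ctranspose g ** g = mat 1" by (simp add: matrix_left_right_inverse)
  have "g ** matrix_inv g = mat 1 \<and> matrix_inv g ** g = mat 1"
    unfolding matrix_inv_def by (rule someI[of _ "ctranspose g"]) (simp add: 1 2)
  then show 3: "g ** matrix_inv g = mat 1" "matrix_inv g ** g = mat 1" by simp_all
  have "matrix_inv g = matrix_inv g ** (g ** ctranspose g)" by (simp add: 1)
  then show "matrix_inv g = ctranspose g" by (simp add: matrix_mul_assoc 3)
qed

lemma commutes_\<sigma>3_iff: "\<sigma>3 ** k = k ** \<sigma>3 \<longleftrightarrow> diag_part k = k"
  by (auto simp: vec_eq_iff forall_2 matrix_matrix_mult_def sum_2 \<sigma>3_def diag_part_def)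

lemma S2_proj_eq_iff:
  assumes "g \<in> SU2" "h \<in> SU2"
  shows "S2_proj g = S2_proj h \<longleftrightarrow> diag_part (matrix_inv g ** h) = matrix_inv g ** h"
proof -
  have "\<sigma>3 ** (matrix_inv g ** h) = matrix_inv g ** S2_proj g ** h"
    by (simp add: S2_proj_def matrix_mul_assoc SU2_inv(3)[OF assms(1)])
  moreover have "matrix_inv g ** h ** \<sigma>3 = matrix_inv g ** S2_proj h ** h"
    by (simp add: S2_proj_def SU2_inv(3)[OF assms(2)] flip: matrix_mul_assoc)
  moreover have "S2_proj g = S2_proj h" if "matrix_inv g ** S2_proj g ** h = matrix_inv g ** S2_proj h ** h"
  proof -
    have "g ** (matrix_inv g ** X ** h) ** matrix_inv h = X" for X
      by (metis SU2_inv(2)[OF assms(1)] SU2_inv(2)[OF assms(2)] matrix_mul_assoc matrix_mul_lid matrix_mul_rid)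
    then show ?thesis using that by metis
  qed
  ultimately show ?thesis by (metis commutes_\<sigma>3_iff)
qed

lemma S2_eq: "S2 = {X. hermitian X \<and> trace X = 0 \<and> mink X X = 1}"
proof (intro equalityI subsetI)
  have "hermitian (S2_proj g) \<and> trace (S2_proj g) = 0 \<and> mink (S2_proj g) (S2_proj g) = 1"
    if g: "g \<in> SU2" for g
  proof -
    have h: "S2_proj g = g ** \<sigma>3 ** ctranspose g" by (simp add: S2_proj_def SU2_inv[OF g])
    have "hermitian (S2_proj g)" unfolding h
      by (simp add: hermitian_def vec_eq_iff forall_2 ctranspose_def transpose_def
          matrix_matrix_mult_def sum_2 \<sigma>3_def algebra_simps)
    moreover have "trace (S2_proj g) = trace (matrix_inv g ** (g ** \<sigma>3))"
      unfolding S2_proj_def by (rule trace_mul_sym)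
    then have "trace (S2_proj g) = 0"
      by (simp add: matrix_mul_assoc SU2_inv(3)[OF g]) (simp add: trace_def sum_2 \<sigma>3_def)
    moreover have "det (S2_proj g) = det (g ** matrix_inv g) * det \<sigma>3"
      by (simp add: S2_proj_def det_mul)
    then have "mink (S2_proj g) (S2_proj g) = 1"
      by (simp add: mink_self SU2_inv(2)[OF g]) (simp add: det_2 \<sigma>3_def)
    ultimately show ?thesis by blast
  qed
  then show "X \<in> {X. hermitian X \<and> trace X = 0 \<and> mink X X = 1}" if "X \<in> S2" for X
    using that by (auto simp: S2_def)
next
  fix X :: cmat
  assume "X \<in> {X. hermitian X \<and> trace X = 0 \<and> mink X X = 1}"
  then have her: "ctranspose X = X" and tr: "X$1$1 + X$2$2 = 0" and det: "det X = -1"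
    by (auto simp: hermitian_def trace_def sum_2 mink_self) (metis add.inverse_inverse)
  define x where "x = Re (X$1$1)"
  define b where "b = X$1$2"
  have "cnj (X$1$1) = X$1$1" "X$2$1 = cnj b"
    using her by (auto simp: ctranspose_def vec_eq_iff forall_2 transpose_def b_def)
  then have X: "X$1$1 = of_real x" "X$1$2 = b" "X$2$1 = cnj b" "X$2$2 = - of_real x"
    using tr by (auto simp: x_def b_def complex_eq_iff eq_neg_iff_add_eq_0 add.commute)
  have xb: "b * cnj b = 1 - of_real x * of_real x"
    using det by (simp add: det_2 X algebra_simps)
  show "X \<in> S2"
  proof (cases "x = -1")
    case True
    define g :: cmat where "g = vector [vector [0, -1], vector [1, 0]]"
    have g: "g \<in> SU2"
      by (simp add: SU2_def g_def vec_eq_iff forall_2 matrix_matrix_mult_def sum_2 det_2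
          ctranspose_def transpose_def mat_def)
    have "b = 0" using xb True by simp
    then have "X = S2_proj g"
      unfolding S2_proj_def SU2_inv(1)[OF g]
      by (simp add: g_def \<sigma>3_def vec_eq_iff forall_2 matrix_matrix_mult_def sum_2
          ctranspose_def transpose_def X True)
    then show ?thesis using g by (auto simp: S2_def)
  next
    case False
    have "1 - x * x = (cmod b)\<^sup>2"
      using xb by (metis complex_norm_square of_real_1 of_real_diff of_real_eq_iff of_real_mult)
    then have "x * x \<le> 1" by (metis diff_ge_0_iff_ge zero_le_power2)
    then have "- 1 \<le> x" by (metis abs_le_square_iff abs_one abs_le_iff one_power2 power2_eq_square
        minus_le_iff)
    then have pos: "0 < 1 + x" using False by linarith
    define r where "r = 1 / sqrt (2 * (1 + x))"
    have "r * r * (2 * (1 + x)) = 1" using pos by (simp add: r_def)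
    then have r: "complex_of_real r * of_real r * (2 * (1 + of_real x)) = 1"
      by (metis of_real_1 of_real_add of_real_mult of_real_numeral)
    define g :: cmat where "g = vector [vector [r * (1 + x), - r * b], vector [r * cnj b, r * (1 + x)]]"
    have n: "of_real r * (1 + of_real x) * (of_real r * (1 + of_real x)) +
        of_real r * b * (of_real r * cnj b) = 1"
      using r xb by algebra
    have g: "g \<in> SU2"
      using n by (simp add: SU2_def g_def vec_eq_iff forall_2 matrix_matrix_mult_def sum_2 det_2
          ctranspose_def transpose_def mat_def) (simp add: algebra_simps)
    have "X ** g = g ** \<sigma>3"
      using xb by (simp add: g_def \<sigma>3_def vec_eq_iff forall_2 matrix_matrix_mult_def sum_2 X) algebra
    then have "X = S2_proj g"
      unfolding S2_proj_def by (metis SU2_inv(2)[OF g] matrix_mul_assoc matrix_mul_rid)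
    then show ?thesis using g by (auto simp: S2_def)
  qed
qed



section \<open>Calculus on open subsets of the plane\<close>

definition d_z :: "(complex \<Rightarrow> cmat) \<Rightarrow> complex \<Rightarrow> cmat"
  where "d_z f z = cscale (1/2)
    (frechet_derivative f (at z) 1 - cscale \<i> (frechet_derivative f (at z) \<i>))"

definition d_zbar :: "(complex \<Rightarrow> cmat) \<Rightarrow> complex \<Rightarrow> cmat"
  where "d_zbar f z = cscale (1/2)
    (frechet_derivative f (at z) 1 + cscale \<i> (frechet_derivative f (at z) \<i>))"

text \<open>Real differentiability of class \<open>C\<^sup>k\<close> and \<open>C\<^sup>\<infinity>\<close>, meant for open \<open>D\<close>.\<close>

primrec Ck_on :: "nat \<Rightarrow> complex set \<Rightarrow> (complex \<Rightarrow> cmat) \<Rightarrow> bool" where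
  "Ck_on 0 D f \<longleftrightarrow> continuous_on D f"
| "Ck_on (Suc k) D f \<longleftrightarrow> (\<forall>z\<in>D. f differentiable (at z)) \<and>
     (\<forall>v. Ck_on k D (\<lambda>z. frechet_derivative f (at z) v))"

definition smooth_on :: "complex set \<Rightarrow> (complex \<Rightarrow> cmat) \<Rightarrow> bool"
  where "smooth_on D f \<longleftrightarrow> (\<forall>k. Ck_on k D f)"

text \<open>A matrix-valued 1-form \<open>\<omega>\<close> maps a point \<open>z\<close> and a real tangent vector \<open>v\<close> to \<open>\<omega> z v\<close>;
  a 2-form maps a point and two tangent vectors to a matrix.\<close>

type_synonym form1 = "complex \<Rightarrow> complex \<Rightarrow> cmat"
type_synonym form2 = "complex \<Rightarrow> complex \<Rightarrow> complex \<Rightarrow> cmat"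

definition maurer_cartan :: "(complex \<Rightarrow> cmat) \<Rightarrow> form1"
  where "maurer_cartan F z v = matrix_inv (F z) ** frechet_derivative F (at z) v"

definition form_10 :: "form1 \<Rightarrow> form1"
  where "form_10 \<omega> z v = cscale (1/2) (\<omega> z v - cscale \<i> (\<omega> z (\<i> * v)))"

definition form_01 :: "form1 \<Rightarrow> form1"
  where "form_01 \<omega> z v = cscale (1/2) (\<omega> z v + cscale \<i> (\<omega> z (\<i> * v)))"

definition is_type_10 :: "complex set \<Rightarrow> form1 \<Rightarrow> bool"
  where "is_type_10 D \<omega> \<longleftrightarrow> (\<forall>z\<in>D. \<forall>v. \<omega> z v = cscale v (\<omega> z 1))"

definition is_type_01 :: "complex set \<Rightarrow> form1 \<Rightarrow> bool"
  where "is_type_01 D \<omega> \<longleftrightarrow> (\<forall>z\<in>D. \<forall>v. \<omega> z v = cscale (cnj v) (\<omega> z 1))"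

definition ext_deriv :: "form1 \<Rightarrow> form2"
  where "ext_deriv \<omega> z v w =
    frechet_derivative (\<lambda>x. \<omega> x w) (at z) v - frechet_derivative (\<lambda>x. \<omega> x v) (at z) w"

definition bracket_wedge :: "form1 \<Rightarrow> form1 \<Rightarrow> form2"
  where "bracket_wedge \<alpha> \<beta> z v w = commutator (\<alpha> z v) (\<beta> z w) - commutator (\<alpha> z w) (\<beta> z v)"


section \<open>Harmonic maps into the sphere and extended frames\<close>

text \<open>The equation is \<open>\<Delta>N + \<bar>dN\<bar>\<^sup>2 N = 0\<close>, where \<open>\<Delta>N\<close> is four times \<open>d_zbar (d_z N)\<close> and
  \<open>\<bar>dN\<bar>\<^sup>2\<close> is four times \<open>mink (d_z N) (d_zbar N)\<close>.\<close>

definition harmonic_map_S2 :: "complex set \<Rightarrow> (complex \<Rightarrow> cmat) \<Rightarrow> bool"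
  where "harmonic_map_S2 D N \<longleftrightarrow> smooth_on D N \<and> N ` D \<subseteq> S2 \<and>
    (\<forall>z\<in>D. d_zbar (d_z N) z + cscale (mink (d_z N z) (d_zbar N z)) (N z) = 0)"

definition hopf_differential :: "(complex \<Rightarrow> cmat) \<Rightarrow> complex \<Rightarrow> complex"
  where "hopf_differential N z = mink (d_z N z) (d_z N z)"

definition non_conformal :: "complex set \<Rightarrow> (complex \<Rightarrow> cmat) \<Rightarrow> bool"
  where "non_conformal D N \<longleftrightarrow> (\<exists>z\<in>D. hopf_differential N z \<noteq> 0)"

text \<open>The first argument of \<open>F\<close> is the loop parameter, the second the point of \<open>D\<close>.\<close>

definition extended_frame ::
  "complex set \<Rightarrow> (complex \<Rightarrow> cmat) \<Rightarrow> (complex \<Rightarrow> complex \<Rightarrow> cmat) \<Rightarrow> bool"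
  where "extended_frame D N F \<longleftrightarrow>
    (\<forall>\<theta>\<in>sphere 0 1. smooth_on D (F \<theta>)) \<and>
    (\<forall>z\<in>D. (\<lambda>\<theta>. F \<theta> z) \<in> LambdaSU2) \<and>
    (\<forall>z\<in>D. S2_proj (F 1 z) = N z) \<and>
    (\<exists>\<alpha>1' \<alpha>0 \<alpha>1''.
      is_type_10 D \<alpha>1' \<and> is_type_01 D \<alpha>1'' \<and> (\<forall>z\<in>D. linear (\<alpha>0 z)) \<and>
      (\<forall>z\<in>D. \<forall>v. offdiag_part (\<alpha>1' z v) = \<alpha>1' z v \<and>
                 diag_part (\<alpha>0 z v) = \<alpha>0 z v \<and>
                 offdiag_part (\<alpha>1'' z v) = \<alpha>1'' z v) \<and>
      (\<forall>\<theta>\<in>sphere 0 1. \<forall>z\<in>D. \<forall>v. maurer_cartan (F \<theta>) z v =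
         cscale (inverse \<theta>) (\<alpha>1' z v) + \<alpha>0 z v + cscale \<theta> (\<alpha>1'' z v)))"


section \<open>The deformed Maurer--Cartan form\<close>

definition Omega1' :: "form1 \<Rightarrow> form1"
  where "Omega1' \<omega> = form_10 (\<lambda>z v. offdiag_part (\<omega> z v))"

definition Omega1'' :: "form1 \<Rightarrow> form1"
  where "Omega1'' \<omega> = form_01 (\<lambda>z v. offdiag_part (\<omega> z v))"

definition beta1' :: "real \<Rightarrow> form1 \<Rightarrow> form1"
  where "beta1' a \<omega> z v =
    (1/4 * (a - 1)) *\<^sub>R ((\<sigma>0 - \<sigma>3) ** Omega1' \<omega> z v ** (\<sigma>0 + \<sigma>3))"

definition beta1'' :: "real \<Rightarrow> form1 \<Rightarrow> form1"
  where "beta1'' a \<omega> z v =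
    (1/4 * (inverse a - 1)) *\<^sub>R ((\<sigma>0 + \<sigma>3) ** Omega1'' \<omega> z v ** (\<sigma>0 - \<sigma>3))"

definition Omega :: "(complex \<Rightarrow> complex \<Rightarrow> cmat) \<Rightarrow> real \<Rightarrow> complex \<Rightarrow> form1"
  where "Omega F a \<theta> z v = maurer_cartan (F \<theta>) z v +
    beta1' a (maurer_cartan (F \<theta>)) z v + beta1'' a (maurer_cartan (F \<theta>)) z v"


section \<open>Surfaces in hyperbolic 3-space\<close>

definition singular_set :: "complex set \<Rightarrow> (complex \<Rightarrow> cmat) \<Rightarrow> complex set"
  where "singular_set D f = {z\<in>D. \<not> inj (frechet_derivative f (at z))}"

text \<open>Away from the singular set the induced metric is \<open>exp (2 * u) dz dzbar\<close>.\<close>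

definition conformal_immersion_isolated_singularities ::
  "complex set \<Rightarrow> (complex \<Rightarrow> cmat) \<Rightarrow> (complex \<Rightarrow> real) \<Rightarrow> bool"
  where "conformal_immersion_isolated_singularities D f u \<longleftrightarrow>
    smooth_on D f \<and> f ` D \<subseteq> H3 \<and> discrete (singular_set D f) \<and>
    (\<forall>z\<in>D - singular_set D f. \<forall>v w.
       mink (frechet_derivative f (at z) v) (frechet_derivative f (at z) w) =
       complex_of_real (exp (2 * u z) * (v \<bullet> w)))"

text \<open>Orthogonality to \<open>f z\<close> says that \<open>N z\<close> is tangent to hyperbolic space at \<open>f z\<close>.\<close>

definition unit_normal_field ::
  "complex set \<Rightarrow> (complex \<Rightarrow> cmat) \<Rightarrow> (complex \<Rightarrow> cmat) \<Rightarrow> bool"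
  where "unit_normal_field U f N \<longleftrightarrow> smooth_on U N \<and>
    (\<forall>z\<in>U. hermitian (N z) \<and> mink (N z) (N z) = 1 \<and> mink (N z) (f z) = 0 \<and>
       (\<forall>v. mink (N z) (frechet_derivative f (at z) v) = 0))"

definition has_mean_curvature ::
  "complex set \<Rightarrow> (complex \<Rightarrow> cmat) \<Rightarrow> (complex \<Rightarrow> real) \<Rightarrow> (complex \<Rightarrow> cmat) \<Rightarrow>
   (complex \<Rightarrow> real) \<Rightarrow> bool"
  where "has_mean_curvature U f u N H \<longleftrightarrow>
    (\<forall>z\<in>U. mink (d_zbar (d_z f) z) (N z) = complex_of_real (1/2 * H z * exp (2 * u z)))"

end

theory Submission
  imports Defs "HOL-Complex_Analysis.Conformal_Mappings"
begin

text \<open>Write the Maurer--Cartan form of the extended frame at the loop parameter \<open>\<lambda>\<close> as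
  \<open>\<lambda>\<^sup>-\<^sup>1 A dz + \<alpha> + \<lambda> B dzbar\<close>, where \<open>\<alpha>\<close> is diagonal and \<open>A\<close> is off-diagonal with entries
  \<open>p\<close> (above) and \<open>q\<close> (below).  The frame is unitary for \<open>\<bar>\<lambda>\<bar> = 1\<close>, which forces \<open>B = - A\<^sup>*\<close> and makes
  \<open>\<alpha>\<close> skew-Hermitian.  The curvature of this form is a Laurent polynomial in \<open>\<lambda>\<close> with the three powers
  \<open>-1, 0, 1\<close>.  It vanishes on the unit circle, hence all its coefficients do, and so the form
  is flat for every \<open>\<lambda> \<noteq> 0\<close> (\<open>flat_punctured_plane\<close>).

  The deformed form multiplies \<open>q\<close> by \<open>a\<close> and divides the upper entry of \<open>B\<close> by \<open>a\<close>.  This is the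
  same as moving the loop parameter from \<open>\<theta>\<close> to \<open>\<theta> / \<surd>a\<close>, off the unit circle, and
  conjugating by the constant matrix \<open>diag(1, \<surd>a)\<close> (\<open>Omega_eq_diag_conj\<close>).  Constant
  conjugation preserves flatness, which is part (i).

  For part (ii), \<open>f = F F\<^sup>*\<close> has differential \<open>F (\<Omega> + \<Omega>\<^sup>*) F\<^sup>*\<close>.  In \<open>\<Omega> + \<Omega>\<^sup>*\<close> the contributions
  of \<open>\<alpha>\<close> and of \<open>p\<close> cancel; what remains is off-diagonal with lower entry
  \<open>(a - a\<^sup>-\<^sup>1) \<theta>\<^sup>-\<^sup>1 q dz\<close>, and its upper entry is the complex conjugate of that.  As \<open>det F = 1\<close>, the
  Minkowski product does not see the outer factors \<open>F\<close> and \<open>F\<^sup>*\<close>.  So the induced metric is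
  \<open>(a - a\<^sup>-\<^sup>1)\<^sup>2 \<bar>q\<bar>\<^sup>2 dz dzbar\<close>, which is conformal away from the zeros of \<open>q\<close>, and one more derivative
  gives \<open>\<langle>\<partial>\<^sup>2f/\<partial>z\<partial>zbar, N\<rangle> = (a - a\<^sup>-\<^sup>1) (a + a\<^sup>-\<^sup>1) \<bar>q\<bar>\<^sup>2 / 2\<close>.  Dividing,
  \<open>H = (a + a\<^sup>-\<^sup>1) / (a - a\<^sup>-\<^sup>1)\<close>.

  The singular set is thus the zero set of \<open>q\<close>.  Flatness says that \<open>p\<close> and \<open>q\<close> satisfy
  \<open>\<partial>p/\<partial>zbar = - \<kappa> p\<close> and \<open>\<partial>q/\<partial>zbar = \<kappa> q\<close> with the same \<open>\<kappa>\<close>, so \<open>p q\<close> is holomorphic.  The Hopf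
  differential of the harmonic map is \<open>- 4 p q dz\<^sup>2\<close>; it is not identically zero, and the identity
  theorem makes the zeros of \<open>p q\<close>, among them those of \<open>q\<close>, isolated.\<close>

section \<open>Symmetry of second derivatives\<close>

text \<open>The second difference over the parallelogram \<open>t v, t w\<close> is \<open>t\<^sup>2 H w + o(t\<^sup>2)\<close>: the mean value theorem
  in the direction \<open>v\<close> turns it into a first difference of the partial derivative \<open>x \<mapsto> G x v\<close>, and
  this is differentiable at \<open>z\<close>.  Because the second difference is symmetric in \<open>v\<close> and \<open>w\<close>, so
  is its leading coefficient.\<close>

lemma second_difference_estimate:
  fixes g :: "'a::real_normed_vector \<Rightarrow> real"
  assumes S: "open S" "z \<in> S"
    and g: "\<And>x. x \<in> S \<Longrightarrow> (g has_derivative G x) (at x)"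
    and H: "((\<lambda>x. G x v) has_derivative H) (at z)"
    and e: "e > 0"
  shows "eventually (\<lambda>t. \<bar>(g (z + t *\<^sub>R v + t *\<^sub>R w) - g (z + t *\<^sub>R v) - g (z + t *\<^sub>R w) + g z) - t\<^sup>2 * H w\<bar>
           \<le> e * t\<^sup>2 * (2 * norm v + norm w)) (at_right (0::real))"
proof -
  obtain r where r: "r > 0" "ball z r \<subseteq> S" using S by (meson openE)
  obtain d where d: "d > 0"
    and dH: "\<And>y. norm (y - z) < d \<Longrightarrow> \<bar>G y v - G z v - H (y - z)\<bar> \<le> e * norm (y - z)"
    using H e unfolding has_derivative_at_alt by (metis real_norm_def)
  define m where "m = min r d"
  have "m > 0" using r d by (simp add: m_def)
  have Hlin: "linear H" using H by (rule has_derivative_linear)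
  \<comment> \<open>The summand 1 keeps the bound on \<open>t\<close> meaningful when \<open>v = w = 0\<close>.\<close>
  define N where "N = norm v + norm w + 1"
  have "N > 0" by (simp add: N_def add_nonneg_pos)
  have "eventually (\<lambda>t. 0 < t \<and> t < m / N) (at_right (0::real))"
    using \<open>m > 0\<close> \<open>N > 0\<close> by (auto simp: eventually_at_right_field intro!: exI[of _ "m / N"])
  then show ?thesis
  proof (rule eventually_mono)
    fix t :: real assume t: "0 < t \<and> t < m / N"
    have small: "norm (s *\<^sub>R v + s' *\<^sub>R w) < m" if "0 \<le> s" "s \<le> t" "0 \<le> s'" "s' \<le> t" for s s'
    proof -
      have "norm (s *\<^sub>R v + s' *\<^sub>R w) \<le> s * norm v + s' * norm w"
        using that by (smt (verit, best) norm_scaleR norm_triangle_ineq)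
      also have "\<dots> \<le> t * norm v + t * norm w"
        using that by (intro add_mono mult_right_mono) auto
      also have "\<dots> \<le> t * N" using t by (simp add: N_def algebra_simps)
      also have "\<dots> < m" using t \<open>N > 0\<close> by (simp add: field_simps)
      finally show ?thesis .
    qed
    define \<phi> where "\<phi> s = g (z + s *\<^sub>R v + t *\<^sub>R w) - g (z + s *\<^sub>R v)" for s
    have inS: "z + s *\<^sub>R v + s' *\<^sub>R w \<in> S" if "0 \<le> s" "s \<le> t" "0 \<le> s'" "s' \<le> t" for s s'
    proof -
      have "dist (z + (s *\<^sub>R v + s' *\<^sub>R w)) z < r"
        using small[OF that] by (simp add: dist_norm m_def)
      then show ?thesis using r by (auto simp: add.assoc dist_commute)
    qed
    have der: "(\<phi> has_derivative (\<lambda>h. G (z + s *\<^sub>R v + t *\<^sub>R w) (h *\<^sub>R v) - G (z + s *\<^sub>R v) (h *\<^sub>R v))) (at s)"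
      if "0 \<le> s" "s \<le> t" for s
    proof -
      have 1: "((\<lambda>s. z + s *\<^sub>R v + t *\<^sub>R w) has_derivative (\<lambda>h. h *\<^sub>R v)) (at s)"
        by (auto intro!: derivative_eq_intros)
      have 2: "((\<lambda>s. z + s *\<^sub>R v) has_derivative (\<lambda>h. h *\<^sub>R v)) (at s)"
        by (auto intro!: derivative_eq_intros)
      have "z + s *\<^sub>R v + t *\<^sub>R w \<in> S" "z + s *\<^sub>R v \<in> S"
        using inS[of s t] inS[of s 0] that t by auto
      from has_derivative_diff[OF has_derivative_compose[OF 1 g[OF this(1)]] has_derivative_compose[OF 2 g[OF this(2)]]]
      show ?thesis by (simp add: \<phi>_def[abs_def])
    qed
    \<comment> \<open>The second difference is \<open>\<phi> t - \<phi> 0\<close>, so the mean value theorem applies to \<open>\<phi>\<close>.\<close>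
    have "\<exists>x\<in>{0<..<t}. \<phi> t - \<phi> 0 = G (z + x *\<^sub>R v + t *\<^sub>R w) ((t - 0) *\<^sub>R v) - G (z + x *\<^sub>R v) ((t - 0) *\<^sub>R v)"
    proof (rule mvt_simple[where f' = "\<lambda>x h. G (z + x *\<^sub>R v + t *\<^sub>R w) (h *\<^sub>R v) - G (z + x *\<^sub>R v) (h *\<^sub>R v)"])
      show "0 < t" using t by simp
      show "(\<phi> has_derivative (\<lambda>h. G (z + s *\<^sub>R v + t *\<^sub>R w) (h *\<^sub>R v) - G (z + s *\<^sub>R v) (h *\<^sub>R v)))
        (at s within {0..t})" if "0 \<le> s" "s \<le> t" for s
        using der[OF that] by (rule has_derivative_at_withinI)
    qed
    then obtain x where x: "0 < x" "x < t" and
      eq: "\<phi> t - \<phi> 0 = G (z + x *\<^sub>R v + t *\<^sub>R w) (t *\<^sub>R v) - G (z + x *\<^sub>R v) (t *\<^sub>R v)" by auto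
    have lin: "linear (G (z + x *\<^sub>R v + t *\<^sub>R w))" "linear (G (z + x *\<^sub>R v))"
      using inS[of x t] inS[of x 0] x t by (auto intro!: has_derivative_linear[OF g])
    have eq2: "\<phi> t - \<phi> 0 = t * (G (z + x *\<^sub>R v + t *\<^sub>R w) v - G (z + x *\<^sub>R v) v)"
      using eq lin by (simp add: linear_scale algebra_simps)
    have n1: "norm (x *\<^sub>R v + t *\<^sub>R w) < d" "norm (x *\<^sub>R v) < d"
      using small[of x t] small[of x 0] x t by (auto simp: m_def)
    have a1: "\<bar>G (z + x *\<^sub>R v + t *\<^sub>R w) v - G z v - H (x *\<^sub>R v + t *\<^sub>R w)\<bar> \<le> e * norm (x *\<^sub>R v + t *\<^sub>R w)"
      using dH[of "z + x *\<^sub>R v + t *\<^sub>R w"] n1 by (simp add: add.assoc)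
    have a2: "\<bar>G (z + x *\<^sub>R v) v - G z v - H (x *\<^sub>R v)\<bar> \<le> e * norm (x *\<^sub>R v)"
      using dH[of "z + x *\<^sub>R v"] n1 by simp
    have Hs: "H (x *\<^sub>R v + t *\<^sub>R w) = H (x *\<^sub>R v) + t * H w"
      using Hlin by (simp add: linear_add linear_scale)
    have nx: "norm (x *\<^sub>R v) \<le> t * norm v" using x by (simp add: mult_right_mono)
    have nxt: "norm (x *\<^sub>R v + t *\<^sub>R w) \<le> t * norm v + t * norm w"
      using norm_triangle_ineq[of "x *\<^sub>R v" "t *\<^sub>R w"] nx t by simp
    have "e * norm (x *\<^sub>R v + t *\<^sub>R w) + e * norm (x *\<^sub>R v) \<le> e * (t * norm v + t * norm w) + e * (t * norm v)"
      using nx nxt e by (intro add_mono mult_left_mono) auto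
    then have "\<bar>(G (z + x *\<^sub>R v + t *\<^sub>R w) v - G (z + x *\<^sub>R v) v) - t * H w\<bar> \<le> e * t * (2 * norm v + norm w)"
      using a1 a2 Hs by (simp add: algebra_simps)
    then have "t * \<bar>(G (z + x *\<^sub>R v + t *\<^sub>R w) v - G (z + x *\<^sub>R v) v) - t * H w\<bar> \<le> t * (e * t * (2 * norm v + norm w))"
      using t by (intro mult_left_mono) auto
    moreover have "t * \<bar>(G (z + x *\<^sub>R v + t *\<^sub>R w) v - G (z + x *\<^sub>R v) v) - t * H w\<bar>
       = \<bar>(\<phi> t - \<phi> 0) - t\<^sup>2 * H w\<bar>"
    proof -
      have "\<phi> t - \<phi> 0 - t\<^sup>2 * H w = t * ((G (z + x *\<^sub>R v + t *\<^sub>R w) v - G (z + x *\<^sub>R v) v) - t * H w)"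
        unfolding eq2 by (simp add: power2_eq_square algebra_simps)
      then show ?thesis using t by (simp add: abs_mult)
    qed
    moreover have "\<phi> t - \<phi> 0 = g (z + t *\<^sub>R v + t *\<^sub>R w) - g (z + t *\<^sub>R v) - g (z + t *\<^sub>R w) + g z"
      by (simp add: \<phi>_def)
    ultimately show "\<bar>(g (z + t *\<^sub>R v + t *\<^sub>R w) - g (z + t *\<^sub>R v) - g (z + t *\<^sub>R w) + g z) - t\<^sup>2 * H w\<bar>
           \<le> e * t\<^sup>2 * (2 * norm v + norm w)"
      by (simp add: power2_eq_square mult_ac)
  qed
qed

lemma symmetric_second_derivative_real:
  fixes g :: "'a::real_normed_vector \<Rightarrow> real"
  assumes S: "open S" "z \<in> S"
    and g: "\<And>x. x \<in> S \<Longrightarrow> (g has_derivative G x) (at x)"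
    and Hv: "((\<lambda>x. G x v) has_derivative Hv) (at z)"
    and Hw: "((\<lambda>x. G x w) has_derivative Hw) (at z)"
  shows "Hv w = Hw v"
proof -
  \<comment> \<open>The sum of the two error constants, made positive by adding 1.\<close>
  define C where "C = 3 * norm v + 3 * norm w + 1"
  have C: "C > 0" by (simp add: C_def add_nonneg_pos)
  have "\<bar>Hv w - Hw v\<bar> \<le> 0 + e" if "e > 0" for e
  proof -
    have eC: "e / C > 0" using that C by simp
    have "eventually (\<lambda>t. 0 < t) (at_right (0::real))" by (simp add: eventually_at_right_less)
    moreover have "eventually (\<lambda>t. \<bar>(g (z + t *\<^sub>R v + t *\<^sub>R w) - g (z + t *\<^sub>R v) - g (z + t *\<^sub>R w) + g z) - t\<^sup>2 * Hv w\<bar>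
           \<le> e / C * t\<^sup>2 * (2 * norm v + norm w)) (at_right 0)"
      by (rule second_difference_estimate[where G = G, OF S _ Hv eC]) (rule g)
    moreover have "eventually (\<lambda>t. \<bar>(g (z + t *\<^sub>R w + t *\<^sub>R v) - g (z + t *\<^sub>R w) - g (z + t *\<^sub>R v) + g z) - t\<^sup>2 * Hw v\<bar>
           \<le> e / C * t\<^sup>2 * (2 * norm w + norm v)) (at_right 0)"
      by (rule second_difference_estimate[where G = G, OF S _ Hw eC]) (rule g)
    ultimately have "eventually (\<lambda>t::real. \<bar>Hv w - Hw v\<bar> \<le> e) (at_right 0)"
    proof eventually_elim
      case (elim t)
      have sw: "z + t *\<^sub>R w + t *\<^sub>R v = z + t *\<^sub>R v + t *\<^sub>R w" by simp
      have "\<bar>t\<^sup>2 * Hv w - t\<^sup>2 * Hw v\<bar> \<le> e / C * t\<^sup>2 * (2 * norm v + norm w) + e / C * t\<^sup>2 * (2 * norm w + norm v)"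
        using elim(2,3) unfolding sw by linarith
      also have "\<dots> = e / C * t\<^sup>2 * ((2 * norm v + norm w) + (2 * norm w + norm v))"
        by (rule distrib_left[symmetric])
      also have "(2 * norm v + norm w) + (2 * norm w + norm v) = C - 1" by (simp add: C_def)
      also have "e / C * t\<^sup>2 * (C - 1) \<le> e / C * t\<^sup>2 * C" using that C by (intro mult_left_mono) auto
      also have "\<dots> = t\<^sup>2 * e" using C by simp
      finally have "t\<^sup>2 * \<bar>Hv w - Hw v\<bar> \<le> t\<^sup>2 * e" by (simp add: abs_mult flip: right_diff_distrib)
      then show ?case using elim(1) by simp
    qed
    then show ?thesis by (simp add: eventually_happens)
  qed
  then have "\<bar>Hv w - Hw v\<bar> \<le> 0" by (rule field_le_epsilon)
  then show ?thesis by simp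
qed

lemma symmetric_second_derivative:
  fixes f :: "'a::real_normed_vector \<Rightarrow> 'b::euclidean_space"
  assumes S: "open S" "z \<in> S"
    and f: "\<And>x. x \<in> S \<Longrightarrow> f differentiable (at x)"
    and f': "\<And>v. (\<lambda>x. frechet_derivative f (at x) v) differentiable (at z)"
  shows "frechet_derivative (\<lambda>x. frechet_derivative f (at x) v) (at z) w
       = frechet_derivative (\<lambda>x. frechet_derivative f (at x) w) (at z) v"
proof (rule euclidean_eqI)
  fix b :: 'b assume "b \<in> Basis"
  have 1: "((\<lambda>x. f x \<bullet> b) has_derivative (\<lambda>h. frechet_derivative f (at x) h \<bullet> b)) (at x)" if "x \<in> S" for x
    using f[OF that] by (intro has_derivative_inner_left) (simp add: frechet_derivative_works)
  have 2: "((\<lambda>x. frechet_derivative f (at x) v \<bullet> b) has_derivative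
      (\<lambda>h. frechet_derivative (\<lambda>x. frechet_derivative f (at x) v) (at z) h \<bullet> b)) (at z)" for v
    using f'[of v] by (intro has_derivative_inner_left) (simp add: frechet_derivative_works)
  show "frechet_derivative (\<lambda>x. frechet_derivative f (at x) v) (at z) w \<bullet> b
       = frechet_derivative (\<lambda>x. frechet_derivative f (at x) w) (at z) v \<bullet> b"
    by (rule symmetric_second_derivative_real[OF S 1 2 2])
qed

section \<open>Calculus of matrix-valued functions\<close>

lemma cscale_nth [simp]: "cscale c A $ i $ j = c * A $ i $ j"
  by (simp add: cscale_def)

lemma ctranspose_nth [simp]: "ctranspose A $ i $ j = cnj (A $ j $ i)"
  by (simp add: ctranspose_def transpose_def)

lemma cmat_eq_iff:
  "A = B \<longleftrightarrow> A$1$1 = B$1$1 \<and> A$1$2 = B$1$2 \<and> A$2$1 = B$2$1 \<and> A$2$2 = B$2$2" for A B :: cmat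
  by (auto simp: vec_eq_iff forall_2)

lemma cmat_mult_nth [simp]: "(A ** B) $ i $ j = A $ i $ 1 * B $ 1 $ j + A $ i $ 2 * B $ 2 $ j" for A B :: cmat
  by (simp add: matrix_matrix_mult_def sum_2)

lemma bounded_bilinear_cmat_mult: "bounded_bilinear ((**) :: cmat \<Rightarrow> cmat \<Rightarrow> cmat)"
  by (rule bilinear_conv_bounded_bilinear[THEN iffD1])
     (auto simp: bilinear_def cmat_eq_iff algebra_simps intro!: linearI)

lemma bounded_linear_cscale: "bounded_linear (cscale c)"
  by (rule linear_conv_bounded_linear[THEN iffD1])
     (auto simp: cmat_eq_iff algebra_simps intro!: linearI)

lemma bounded_linear_ctranspose: "bounded_linear ctranspose"
  by (rule linear_conv_bounded_linear[THEN iffD1])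
     (auto simp: cmat_eq_iff algebra_simps intro!: linearI)

lemma bounded_linear_offdiag_part: "bounded_linear offdiag_part"
  by (rule linear_conv_bounded_linear[THEN iffD1])
     (auto simp: cmat_eq_iff offdiag_part_def algebra_simps intro!: linearI)

lemma bounded_linear_cmat_nth: "bounded_linear (\<lambda>A :: cmat. A $ i $ j)"
  by (intro bounded_linear_compose[OF bounded_linear_vec_nth bounded_linear_vec_nth])

lemma ctranspose_mult: "ctranspose (A ** B) = ctranspose B ** ctranspose A"
  by (simp add: cmat_eq_iff algebra_simps)

lemma det_ctranspose: "det (ctranspose A) = cnj (det A)"
  by (simp add: det_2)

lemma matrix_inv_SL2C:
  assumes "A \<in> SL2C" shows "A ** matrix_inv A = mat 1" "matrix_inv A ** A = mat 1"
proof -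
  have "invertible A" using assms by (simp add: invertible_det_nz SL2C_def)
  then have "A ** matrix_inv A = mat 1 \<and> matrix_inv A ** A = mat 1"
    unfolding matrix_inv_def invertible_def by (rule someI_ex)
  then show "A ** matrix_inv A = mat 1" "matrix_inv A ** A = mat 1" by auto
qed

lemma Ck_on_transform:
  assumes "open D" "\<And>z. z \<in> D \<Longrightarrow> f z = g z" "Ck_on k D f"
  shows "Ck_on k D g"
  using assms(2,3)
proof (induction k arbitrary: f g)
  case 0 then show ?case by (metis Ck_on.simps(1) continuous_on_cong)
next
  case (Suc k)
  have d: "g differentiable (at z) \<and> frechet_derivative g (at z) = frechet_derivative f (at z)" if "z \<in> D" for z
  proof -
    have "(f has_derivative frechet_derivative f (at z)) (at z)"
      using Suc.prems(2) that by (simp add: frechet_derivative_works)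
    then have "(g has_derivative frechet_derivative f (at z)) (at z)"
      using Suc.prems(1) that assms(1) by (metis has_derivative_transform_within_open)
    then show ?thesis by (metis differentiable_def frechet_derivative_at)
  qed
  have "Ck_on k D (\<lambda>z. frechet_derivative g (at z) v)" for v
  proof (rule Suc.IH)
    show "Ck_on k D (\<lambda>z. frechet_derivative f (at z) v)" using Suc.prems(2) by simp
  qed (use d in simp)
  then show ?case using d by simp
qed

lemma Ck_on_differentiable:
  "Ck_on (Suc k) D f \<Longrightarrow> z \<in> D \<Longrightarrow> (f has_derivative frechet_derivative f (at z)) (at z)"
  by (simp add: frechet_derivative_works)

text \<open>\<open>Ck_on\<close> speaks about the Frechet derivative, a choice operator; this rule replaces it by any
  derivative given in closed form on \<open>D\<close>, which is what the inductions below can compute.\<close>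

lemma Ck_on_SucI:
  assumes "open D" "\<And>z. z \<in> D \<Longrightarrow> (f has_derivative f' z) (at z)" "\<And>v. Ck_on k D (\<lambda>z. f' z v)"
  shows "Ck_on (Suc k) D f"
proof -
  have "frechet_derivative f (at z) = f' z" if "z \<in> D" for z
    using assms(2)[OF that] by (metis frechet_derivative_at)
  then have "Ck_on k D (\<lambda>z. frechet_derivative f (at z) v)" for v
    using Ck_on_transform[OF assms(1) _ assms(3), where g = "\<lambda>z. frechet_derivative f (at z) v"] by simp
  then show ?thesis using assms(2) by (auto simp: differentiable_def)
qed

lemma Ck_on_decSuc: "Ck_on (Suc k) D f \<Longrightarrow> Ck_on k D f"
proof (induction k arbitrary: f)
  case 0 then show ?case
    by (auto intro!: continuous_at_imp_continuous_on differentiable_imp_continuous_within)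
next
  case (Suc k)
  then have "Ck_on k D (\<lambda>z. frechet_derivative f (at z) v)" for v
    using Ck_on.simps(2) by blast
  moreover have "\<forall>z\<in>D. f differentiable (at z)" using Suc.prems by simp
  ultimately show ?case by simp
qed

lemma Ck_on_subset: "Ck_on k D f \<Longrightarrow> U \<subseteq> D \<Longrightarrow> Ck_on k U f"
  by (induction k arbitrary: f) (auto intro: continuous_on_subset)

lemma Ck_on_bounded_linear:
  assumes "open D" "bounded_linear L" shows "Ck_on k D f \<Longrightarrow> Ck_on k D (\<lambda>z. L (f z))"
proof (induction k arbitrary: f)
  case 0 then show ?case using bounded_linear.continuous_on[OF assms(2)] by simp
next
  case (Suc k)
  show ?case
    by (rule Ck_on_SucI[OF assms(1) bounded_linear.has_derivative[OF assms(2) Ck_on_differentiable[OF Suc.prems]]])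
       (use Suc in auto)
qed

lemma Ck_on_add:
  assumes "open D" shows "Ck_on k D f \<Longrightarrow> Ck_on k D g \<Longrightarrow> Ck_on k D (\<lambda>z. f z + g z)"
proof (induction k arbitrary: f g)
  case 0 then show ?case by (simp add: continuous_on_add)
next
  case (Suc k)
  show ?case
    by (rule Ck_on_SucI[OF assms has_derivative_add[OF Ck_on_differentiable[OF Suc.prems(1)] Ck_on_differentiable[OF Suc.prems(2)]]])
       (use Suc in auto)
qed

lemma Ck_on_mult:
  assumes "open D" shows "Ck_on k D f \<Longrightarrow> Ck_on k D g \<Longrightarrow> Ck_on k D (\<lambda>z. f z ** g z)"
proof (induction k arbitrary: f g)
  case 0 then show ?case by (simp add: bounded_bilinear.continuous_on[OF bounded_bilinear_cmat_mult])
next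
  case (Suc k)
  have "Ck_on k D f" "Ck_on k D g" by (rule Suc.prems[THEN Ck_on_decSuc])+
  moreover have "Ck_on k D (\<lambda>z. frechet_derivative f (at z) v)"
    "Ck_on k D (\<lambda>z. frechet_derivative g (at z) v)" for v using Suc.prems by auto
  ultimately have smooth': "Ck_on k D (\<lambda>z. f z ** frechet_derivative g (at z) v + frechet_derivative f (at z) v ** g z)" for v
    by (intro Ck_on_add[OF assms] Suc.IH)
  have deriv: "((\<lambda>z. f z ** g z) has_derivative
      (\<lambda>h. f z ** frechet_derivative g (at z) h + frechet_derivative f (at z) h ** g z)) (at z)" if "z \<in> D" for z
    using that by (intro bounded_bilinear.FDERIV[OF bounded_bilinear_cmat_mult]
      Ck_on_differentiable[OF Suc.prems(1)] Ck_on_differentiable[OF Suc.prems(2)])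
  show ?case using deriv smooth' by (rule Ck_on_SucI[OF assms])
qed

lemma smooth_on_transform:
  "open D \<Longrightarrow> (\<And>z. z \<in> D \<Longrightarrow> f z = g z) \<Longrightarrow> smooth_on D f \<Longrightarrow> smooth_on D g"
  unfolding smooth_on_def using Ck_on_transform by blast

lemma smooth_on_has_derivative:
  "smooth_on D f \<Longrightarrow> z \<in> D \<Longrightarrow> (f has_derivative frechet_derivative f (at z)) (at z)"
  unfolding smooth_on_def using Ck_on_differentiable by blast

lemma smooth_on_frechet_derivative:
  "smooth_on D f \<Longrightarrow> smooth_on D (\<lambda>z. frechet_derivative f (at z) v)"
  unfolding smooth_on_def using Ck_on.simps(2) by blast

lemma smooth_on_subset: "smooth_on D f \<Longrightarrow> U \<subseteq> D \<Longrightarrow> smooth_on U f"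
  unfolding smooth_on_def using Ck_on_subset by blast

lemma smooth_on_bounded_linear:
  "open D \<Longrightarrow> bounded_linear L \<Longrightarrow> smooth_on D f \<Longrightarrow> smooth_on D (\<lambda>z. L (f z))"
  unfolding smooth_on_def using Ck_on_bounded_linear by blast

lemma smooth_on_add:
  "open D \<Longrightarrow> smooth_on D f \<Longrightarrow> smooth_on D g \<Longrightarrow> smooth_on D (\<lambda>z. f z + g z)"
  unfolding smooth_on_def using Ck_on_add by blast

lemma smooth_on_mult:
  "open D \<Longrightarrow> smooth_on D f \<Longrightarrow> smooth_on D g \<Longrightarrow> smooth_on D (\<lambda>z. f z ** g z)"
  unfolding smooth_on_def using Ck_on_mult by blast

lemma smooth_on_cscale: "open D \<Longrightarrow> smooth_on D f \<Longrightarrow> smooth_on D (\<lambda>z. cscale c (f z))"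
  by (rule smooth_on_bounded_linear[OF _ bounded_linear_cscale])

lemma smooth_on_ctranspose: "open D \<Longrightarrow> smooth_on D f \<Longrightarrow> smooth_on D (\<lambda>z. ctranspose (f z))"
  by (rule smooth_on_bounded_linear[OF _ bounded_linear_ctranspose])

lemma frechet_derivative_eqI: "(f has_derivative f') (at z) \<Longrightarrow> frechet_derivative f (at z) = f'"
  by (metis frechet_derivative_at)

lemma has_derivative_cmat_mult:
  fixes f g :: "complex \<Rightarrow> cmat"
  assumes "(f has_derivative f') (at z)" "(g has_derivative g') (at z)"
  shows "((\<lambda>z. f z ** g z) has_derivative (\<lambda>h. f z ** g' h + f' h ** g z)) (at z)"
  using bounded_bilinear.FDERIV[OF bounded_bilinear_cmat_mult assms] .

section \<open>Maurer--Cartan forms\<close>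

lemma SU2_subset_SL2C: "SU2 \<subseteq> SL2C" by (auto simp: SU2_def SL2C_def)

lemma smooth_on_maurer_cartan_SU2:
  assumes "open D" "smooth_on D F" "F ` D \<subseteq> SU2"
  shows "smooth_on D (\<lambda>z. maurer_cartan F z v)"
proof -
  have "smooth_on D (\<lambda>z. ctranspose (F z) ** frechet_derivative F (at z) v)"
    by (intro smooth_on_mult smooth_on_ctranspose smooth_on_frechet_derivative assms)
  then show ?thesis
    by (rule smooth_on_transform[OF assms(1), rotated])
       (use assms(3) SU2_inv(1) in \<open>auto simp: maurer_cartan_def image_subset_iff\<close>)
qed

lemma frechet_derivative_eq_mult_maurer_cartan:
  assumes "F z \<in> SL2C"
  shows "frechet_derivative F (at z) v = F z ** maurer_cartan F z v"
  by (simp add: maurer_cartan_def matrix_mul_assoc matrix_inv_SL2C[OF assms])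

text \<open>Differentiate \<open>F F\<^sup>* = 1\<close> and multiply by \<open>F\<^sup>*\<close> from the left and \<open>F\<close> from the right.\<close>

lemma maurer_cartan_SU2_skew:
  assumes "open D" "smooth_on D F" "F ` D \<subseteq> SU2" "z \<in> D"
  shows "ctranspose (maurer_cartan F z v) = - maurer_cartan F z v"
proof -
  let ?F' = "frechet_derivative F (at z)"
  have F': "(F has_derivative ?F') (at z)" by (rule smooth_on_has_derivative[OF assms(2,4)])
  have "((\<lambda>z. F z ** ctranspose (F z)) has_derivative
      (\<lambda>h. F z ** ctranspose (?F' h) + ?F' h ** ctranspose (F z))) (at z)"
    by (intro has_derivative_cmat_mult F' bounded_linear.has_derivative[OF bounded_linear_ctranspose])
  moreover have "((\<lambda>z. F z ** ctranspose (F z)) has_derivative (\<lambda>h. 0)) (at z)"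
    by (rule has_derivative_transform_within_open[OF has_derivative_const[of "mat 1"] assms(1,4)])
       (use assms(3) in \<open>auto simp: SU2_def\<close>)
  ultimately have "(\<lambda>h. F z ** ctranspose (?F' h) + ?F' h ** ctranspose (F z)) = (\<lambda>h. 0)"
    by (rule has_derivative_unique)
  then have 0: "F z ** ctranspose (?F' v) + ?F' v ** ctranspose (F z) = 0" by metis
  have g: "F z \<in> SU2" using assms by auto
  have inv: "ctranspose (F z) ** F z = mat 1" using SU2_inv[OF g] by simp
  have "ctranspose (F z) ** (F z ** ctranspose (?F' v) + ?F' v ** ctranspose (F z)) ** F z
      = (ctranspose (F z) ** F z) ** ctranspose (?F' v) ** F z + ctranspose (F z) ** ?F' v ** (ctranspose (F z) ** F z)"
    by (simp add: matrix_add_ldistrib bounded_bilinear.add_left[OF bounded_bilinear_cmat_mult] matrix_mul_assoc)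
  then have "0 = ctranspose (?F' v) ** F z + ctranspose (F z) ** ?F' v"
    unfolding 0 inv by simp
  moreover have "ctranspose (maurer_cartan F z v) = ctranspose (?F' v) ** F z"
    using SU2_inv(1)[OF g] by (simp add: maurer_cartan_def ctranspose_mult) (simp add: ctranspose_def transpose_def vec_eq_iff)
  moreover have "maurer_cartan F z v = ctranspose (F z) ** ?F' v"
    using SU2_inv(1)[OF g] by (simp add: maurer_cartan_def)
  ultimately show ?thesis by (simp add: eq_neg_iff_add_eq_0)
qed

definition curvature :: "form1 \<Rightarrow> form2"
  where "curvature \<omega> z v w = ext_deriv \<omega> z v w + (1/2) *\<^sub>R bracket_wedge \<omega> \<omega> z v w"

lemma curvature_eq: "curvature \<omega> z v w = ext_deriv \<omega> z v w + commutator (\<omega> z v) (\<omega> z w)"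
proof -
  have "bracket_wedge \<omega> \<omega> z v w = 2 *\<^sub>R commutator (\<omega> z v) (\<omega> z w)"
    by (simp add: bracket_wedge_def commutator_def scaleR_2)
  then show ?thesis by (simp add: curvature_def)
qed

text \<open>With \<open>W = F\<^sup>-\<^sup>1 dF\<close> the second derivative of \<open>F\<close> in the directions \<open>v\<close>, \<open>w\<close> is
  \<open>F (\<partial>\<^sub>w W(v) + W(w) W(v))\<close>; its symmetry in \<open>v\<close> and \<open>w\<close> is the Maurer--Cartan equation.\<close>

lemma curvature_maurer_cartan:
  assumes "open D" "smooth_on D F" "F ` D \<subseteq> SL2C" "z \<in> D"
    and smooth: "\<And>v. smooth_on D (\<lambda>z. maurer_cartan F z v)"
  shows "curvature (maurer_cartan F) z v w = 0"
proof -
  let ?W = "maurer_cartan F"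
  define dW where "dW v = frechet_derivative (\<lambda>x. ?W x v) (at z)" for v
  have Fz: "F z \<in> SL2C" using assms by auto
  have second: "frechet_derivative (\<lambda>x. frechet_derivative F (at x) v) (at z) w
      = F z ** (dW v w + ?W z w ** ?W z v)" for v w
  proof -
    have "((\<lambda>x. F x ** ?W x v) has_derivative
        (\<lambda>h. F z ** dW v h + frechet_derivative F (at z) h ** ?W z v)) (at z)"
      unfolding dW_def
      by (intro has_derivative_cmat_mult smooth_on_has_derivative[OF assms(2,4)]
          smooth_on_has_derivative[OF smooth assms(4)])
    then have "((\<lambda>x. frechet_derivative F (at x) v) has_derivative
        (\<lambda>h. F z ** dW v h + frechet_derivative F (at z) h ** ?W z v)) (at z)"
      by (rule has_derivative_transform_within_open[OF _ assms(1,4)])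
         (use assms(3) frechet_derivative_eq_mult_maurer_cartan in auto)
    then show ?thesis
      by (simp add: frechet_derivative_eqI frechet_derivative_eq_mult_maurer_cartan[where F = F and z = z, OF Fz]
          matrix_add_ldistrib matrix_mul_assoc)
  qed
  have "frechet_derivative (\<lambda>x. frechet_derivative F (at x) v) (at z) w
      = frechet_derivative (\<lambda>x. frechet_derivative F (at x) w) (at z) v"
    using assms(2) smooth_on_frechet_derivative[OF assms(2)] \<open>z \<in> D\<close>
    by (intro symmetric_second_derivative[OF assms(1,4)])
       (auto simp: differentiable_def intro: smooth_on_has_derivative)
  then have "matrix_inv (F z) ** (F z ** (dW v w + ?W z w ** ?W z v))
      = matrix_inv (F z) ** (F z ** (dW w v + ?W z v ** ?W z w))"
    unfolding second by simp
  then have "dW v w + ?W z w ** ?W z v = dW w v + ?W z v ** ?W z w"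
    by (simp add: matrix_mul_assoc matrix_inv_SL2C[OF Fz])
  then show ?thesis
    by (simp add: curvature_eq ext_deriv_def commutator_def dW_def algebra_simps)
qed

section \<open>Loops of flat connections\<close>

definition loop_form :: "(complex \<Rightarrow> cmat) \<Rightarrow> form1 \<Rightarrow> (complex \<Rightarrow> cmat) \<Rightarrow> complex \<Rightarrow> form1"
  where "loop_form A \<alpha> B l z v = cscale (inverse l * v) (A z) + \<alpha> z v + cscale (l * cnj v) (B z)"

text \<open>What an extended frame of a harmonic map into the sphere leaves behind once the frame itself is
  forgotten: a loop of forms, skew-Hermitian and flat for every parameter on the
  unit circle.\<close>

locale loop_connection =
  fixes D :: "complex set" and A B :: "complex \<Rightarrow> cmat" and \<alpha> :: form1
  assumes open_D: "open D"
    and smooth_A: "smooth_on D A"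
    and smooth_\<alpha>: "\<And>v. smooth_on D (\<lambda>z. \<alpha> z v)"
    and offdiag_A: "\<And>z. z \<in> D \<Longrightarrow> offdiag_part (A z) = A z"
    and diag_\<alpha>: "\<And>z v. z \<in> D \<Longrightarrow> diag_part (\<alpha> z v) = \<alpha> z v"
    and B_eq: "\<And>z. z \<in> D \<Longrightarrow> B z = - ctranspose (A z)"
    and skew_\<alpha>: "\<And>z v. z \<in> D \<Longrightarrow> ctranspose (\<alpha> z v) = - \<alpha> z v"
    and flat_circle: "\<And>z l v w. z \<in> D \<Longrightarrow> l \<in> sphere 0 1 \<Longrightarrow> curvature (loop_form A \<alpha> B l) z v w = 0"
begin

lemma smooth_B: "smooth_on D B"
proof -
  have "smooth_on D (\<lambda>z. - ctranspose (A z))"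
    by (intro smooth_on_bounded_linear[OF open_D bounded_linear_minus] smooth_on_ctranspose open_D smooth_A bounded_linear_ctranspose)
  then show ?thesis by (rule smooth_on_transform[OF open_D, rotated]) (simp add: B_eq)
qed

lemma smooth_loop_form: "smooth_on D (\<lambda>z. loop_form A \<alpha> B l z v)"
  unfolding loop_form_def
  by (intro smooth_on_add smooth_on_cscale smooth_\<alpha> smooth_A smooth_B open_D)

text \<open>The coefficients of \<open>l\<^sup>-\<^sup>1\<close>, \<open>1\<close> and \<open>l\<close> in the curvature of \<open>loop_form A \<alpha> B l\<close>.\<close>

definition coeff_minus :: form2 where
  "coeff_minus z v w = cscale w (frechet_derivative A (at z) v) - cscale v (frechet_derivative A (at z) w)
     + cscale w (commutator (\<alpha> z v) (A z)) - cscale v (commutator (\<alpha> z w) (A z))"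

definition coeff_zero :: form2 where
  "coeff_zero z v w = curvature \<alpha> z v w + cscale (v * cnj w - cnj v * w) (commutator (A z) (B z))"

definition coeff_plus :: form2 where
  "coeff_plus z v w = cscale (cnj w) (frechet_derivative B (at z) v) - cscale (cnj v) (frechet_derivative B (at z) w)
     + cscale (cnj w) (commutator (\<alpha> z v) (B z)) - cscale (cnj v) (commutator (\<alpha> z w) (B z))"

text \<open>The powers \<open>l\<^sup>-\<^sup>2\<close> and \<open>l\<^sup>2\<close> do not occur: \<open>A dz\<close> is a matrix times one scalar form, so its bracket with
  itself vanishes, and likewise for \<open>B dzbar\<close>.\<close>

lemma curvature_loop_form:
  assumes z: "z \<in> D" and l: "l \<noteq> 0"
  shows "curvature (loop_form A \<alpha> B l) z v w =
    cscale (inverse l) (coeff_minus z v w) + coeff_zero z v w + cscale l (coeff_plus z v w)"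
proof -
  have d: "frechet_derivative (\<lambda>x. loop_form A \<alpha> B l x v) (at z) =
    (\<lambda>h. cscale (inverse l * v) (frechet_derivative A (at z) h) + frechet_derivative (\<lambda>x. \<alpha> x v) (at z) h
       + cscale (l * cnj v) (frechet_derivative B (at z) h))" for v
    unfolding loop_form_def
    by (intro frechet_derivative_eqI has_derivative_add bounded_linear.has_derivative[OF bounded_linear_cscale]
        smooth_on_has_derivative[OF _ z] smooth_A smooth_\<alpha> smooth_B)
  define m where "m = inverse l"
  have m: "m * l = 1" using l by (simp add: m_def)
  show ?thesis
    unfolding curvature_eq ext_deriv_def d coeff_minus_def coeff_zero_def coeff_plus_def commutator_def
    unfolding loop_form_def m_def[symmetric] cmat_eq_iff
    using m by simp algebra
qed

lemma coefficients_vanish: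
  assumes z: "z \<in> D"
  shows "coeff_minus z v w = 0" "coeff_zero z v w = 0" "coeff_plus z v w = 0"
proof -
  have "cscale (inverse l) (coeff_minus z v w) + coeff_zero z v w + cscale l (coeff_plus z v w) = 0"
    if "l \<in> sphere 0 1" for l
    using flat_circle[OF z that] curvature_loop_form[OF z, of l v w] that by force
  \<comment> \<open>Three parameters on the circle are enough to separate the three coefficients.\<close>
  from this[of 1] this[of "-1"] this[of \<i>]
  have e: "cscale 1 (coeff_minus z v w) + coeff_zero z v w + cscale 1 (coeff_plus z v w) = 0"
    "cscale (-1) (coeff_minus z v w) + coeff_zero z v w + cscale (-1) (coeff_plus z v w) = 0"
    "cscale (-\<i>) (coeff_minus z v w) + coeff_zero z v w + cscale \<i> (coeff_plus z v w) = 0"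
    by (auto simp: inverse_eq_divide)
  have *: "x = 0 \<and> y = 0 \<and> t = 0" if "x + y + t = 0" "- x + y - t = 0" "\<i> * t + y = \<i> * x" for x y t :: complex
  proof -
    have "y = 0" using that(1,2) by algebra
    moreover from this that have "x = t" by simp
    ultimately show ?thesis using that(1) by simp
  qed
  have "coeff_minus z v w $ i $ j = 0 \<and> coeff_zero z v w $ i $ j = 0 \<and> coeff_plus z v w $ i $ j = 0" for i j
    using e[THEN arg_cong[where f = "\<lambda>M. M $ i $ j"]] by (intro *) (auto simp: algebra_simps)
  then show "coeff_minus z v w = 0" "coeff_zero z v w = 0" "coeff_plus z v w = 0"
    by (simp_all add: cmat_eq_iff)
qed

text \<open>The step off the unit circle: a Laurent polynomial whose coefficients vanish is zero everywhere.\<close>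

lemma flat_punctured_plane: "z \<in> D \<Longrightarrow> l \<noteq> 0 \<Longrightarrow> curvature (loop_form A \<alpha> B l) z v w = 0"
  by (simp add: curvature_loop_form coefficients_vanish cmat_eq_iff)

end

section \<open>The deformed form as a move of the loop parameter\<close>

definition diag_conj :: "real \<Rightarrow> cmat \<Rightarrow> cmat"
  where "diag_conj s X = vector [vector [1, 0], vector [0, of_real s]] ** X
    ** vector [vector [1, 0], vector [0, of_real (inverse s)]]"

lemma diag_conj_nth:
  assumes "s \<noteq> 0"
  shows "diag_conj s X $ 1 $ 1 = X $ 1 $ 1" "diag_conj s X $ 1 $ 2 = of_real (inverse s) * X $ 1 $ 2"
    "diag_conj s X $ 2 $ 1 = of_real s * X $ 2 $ 1" "diag_conj s X $ 2 $ 2 = X $ 2 $ 2"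
  using assms by (simp_all add: diag_conj_def)

lemma bounded_linear_diag_conj: "bounded_linear (diag_conj s)"
  by (rule linear_conv_bounded_linear[THEN iffD1])
     (auto simp: cmat_eq_iff diag_conj_def algebra_simps intro!: linearI)

lemma commutator_diag_conj:
  assumes "s \<noteq> 0" shows "commutator (diag_conj s X) (diag_conj s Y) = diag_conj s (commutator X Y)"
proof -
  have "of_real s * inverse (of_real s) = (1::complex)" using assms by simp
  then show ?thesis
    by (simp add: commutator_def cmat_eq_iff diag_conj_nth[OF assms]) algebra
qed

lemma curvature_diag_conj:
  assumes "s \<noteq> 0" "\<And>v. (\<lambda>x. \<omega> x v) differentiable (at z)"
  shows "curvature (\<lambda>z v. diag_conj s (\<omega> z v)) z v w = diag_conj s (curvature \<omega> z v w)"
proof -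
  have "frechet_derivative (\<lambda>x. diag_conj s (\<omega> x v)) (at z)
      = (\<lambda>h. diag_conj s (frechet_derivative (\<lambda>x. \<omega> x v) (at z) h))" for v
    using assms(2)[of v] by (intro frechet_derivative_eqI bounded_linear.has_derivative[OF bounded_linear_diag_conj])
      (simp add: frechet_derivative_works)
  then show ?thesis
    using linear_add[of "diag_conj s"] linear_diff[of "diag_conj s"] bounded_linear_diag_conj[THEN bounded_linear.linear]
    by (simp add: curvature_eq ext_deriv_def commutator_diag_conj[OF assms(1)])
qed

lemma curvature_cong:
  assumes "open D" "z \<in> D" "\<And>x v. x \<in> D \<Longrightarrow> \<omega> x v = \<omega>' x v"
    and "\<And>v. (\<lambda>x. \<omega> x v) differentiable (at z)"
  shows "curvature \<omega> z v w = curvature \<omega>' z v w"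
proof -
  have "frechet_derivative (\<lambda>x. \<omega> x v) (at z) = frechet_derivative (\<lambda>x. \<omega>' x v) (at z)" for v
    using assms by (intro frechet_derivative_transform_within_open[OF assms(4,1,2)]) auto
  then show ?thesis using assms by (simp add: curvature_eq ext_deriv_def)
qed

lemma Omega1'_loop_form:
  assumes "\<And>v. W z v = loop_form A \<alpha> B l z v"
    "offdiag_part (A z) = A z" "offdiag_part (B z) = B z" "\<And>v. diag_part (\<alpha> z v) = \<alpha> z v"
  shows "Omega1' W z v = cscale (inverse l * v) (A z)"
proof -
  have "A z $ 1 $ 1 = 0" "A z $ 2 $ 2 = 0" "B z $ 1 $ 1 = 0" "B z $ 2 $ 2 = 0"
    "\<alpha> z v $ 1 $ 2 = 0" "\<alpha> z v $ 2 $ 1 = 0" for v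
    using assms(2,3) assms(4)[of v] by (auto simp: cmat_eq_iff offdiag_part_def diag_part_def)
  then show ?thesis
    by (simp add: Omega1'_def form_10_def offdiag_part_def assms(1) cmat_eq_iff loop_form_def algebra_simps)
qed

lemma Omega1''_loop_form:
  assumes "\<And>v. W z v = loop_form A \<alpha> B l z v"
    "offdiag_part (A z) = A z" "offdiag_part (B z) = B z" "\<And>v. diag_part (\<alpha> z v) = \<alpha> z v"
  shows "Omega1'' W z v = cscale (l * cnj v) (B z)"
proof -
  have "A z $ 1 $ 1 = 0" "A z $ 2 $ 2 = 0" "B z $ 1 $ 1 = 0" "B z $ 2 $ 2 = 0"
    "\<alpha> z v $ 1 $ 2 = 0" "\<alpha> z v $ 2 $ 1 = 0" for v
    using assms(2,3) assms(4)[of v] by (auto simp: cmat_eq_iff offdiag_part_def diag_part_def)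
  then show ?thesis
    by (simp add: Omega1''_def form_01_def offdiag_part_def assms(1) cmat_eq_iff loop_form_def algebra_simps)
qed

text \<open>Passing from \<open>l\<close> to \<open>l / \<surd>a\<close> multiplies \<open>A\<close> by \<open>\<surd>a\<close> and \<open>B\<close> by \<open>1 / \<surd>a\<close>; conjugation by
  \<open>diag(1, \<surd>a)\<close> multiplies lower entries by \<open>\<surd>a\<close> and divides upper entries by it.  Together the lower
  entry of \<open>A\<close> gains the factor \<open>a\<close>, the upper entry of \<open>B\<close> the factor \<open>1 / a\<close>, and the other
  two entries are unchanged: exactly the effect of adding \<open>beta1'\<close> and \<open>beta1''\<close>.\<close>

lemma Omega_eq_diag_conj:
  assumes "\<And>v. maurer_cartan (Ft l) z v = loop_form A \<alpha> B l z v" "l \<noteq> 0" "a > 0"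
    "offdiag_part (A z) = A z" "offdiag_part (B z) = B z" "\<And>v. diag_part (\<alpha> z v) = \<alpha> z v"
  shows "Omega Ft a l z v = diag_conj (sqrt a) (loop_form A \<alpha> B (l / of_real (sqrt a)) z v)"
proof -
  have "A z $ 1 $ 1 = 0" "A z $ 2 $ 2 = 0" "B z $ 1 $ 1 = 0" "B z $ 2 $ 2 = 0"
    "\<alpha> z v $ 1 $ 2 = 0" "\<alpha> z v $ 2 $ 1 = 0" for v
    using assms(4,5) assms(6)[of v] by (auto simp: cmat_eq_iff offdiag_part_def diag_part_def)
  note zero = this
  define s where "s = complex_of_real (sqrt a)"
  have s: "s * s = of_real a" "s \<noteq> 0" using assms(3) by (simp_all add: s_def flip: of_real_mult)
  have W: "Omega1' (maurer_cartan (Ft l)) z v = cscale (inverse l * v) (A z)"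
    "Omega1'' (maurer_cartan (Ft l)) z v = cscale (l * cnj v) (B z)"
    by (rule Omega1'_loop_form[where B = B and \<alpha> = \<alpha>] Omega1''_loop_form[where A = A and \<alpha> = \<alpha>],
        use assms in simp_all)+
  have g: "diag_conj (sqrt a) X $ 1 $ 1 = X $ 1 $ 1" "diag_conj (sqrt a) X $ 1 $ 2 = inverse s * X $ 1 $ 2"
    "diag_conj (sqrt a) X $ 2 $ 1 = s * X $ 2 $ 1" "diag_conj (sqrt a) X $ 2 $ 2 = X $ 2 $ 2" for X
    using diag_conj_nth[of "sqrt a" X] assms(3) by (simp_all add: s_def)
  have "Omega Ft a l z v = loop_form A \<alpha> B l z v + ((1/4 * (a - 1)) *\<^sub>R ((\<sigma>0 - \<sigma>3) ** cscale (inverse l * v) (A z) ** (\<sigma>0 + \<sigma>3)))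
     + ((1/4 * (inverse a - 1)) *\<^sub>R ((\<sigma>0 + \<sigma>3) ** cscale (l * cnj v) (B z) ** (\<sigma>0 - \<sigma>3)))"
    by (simp add: Omega_def beta1'_def beta1''_def W assms(1))
  also have "\<dots> = diag_conj (sqrt a) (loop_form A \<alpha> B (l / s) z v)"
    using s assms(2,3) unfolding cmat_eq_iff g
    by (simp add: loop_form_def zero \<sigma>0_def \<sigma>3_def mat_def scaleR_conv_of_real[where 'a=complex])
       (simp add: field_simps flip: s(1))
  finally show ?thesis by (simp add: s_def)
qed

lemma (in loop_connection) offdiag_B: "z \<in> D \<Longrightarrow> offdiag_part (B z) = B z"
  using offdiag_A[of z] by (auto simp: cmat_eq_iff offdiag_part_def B_eq)

lemma (in loop_connection) curvature_Omega:
  assumes z: "z \<in> D" and a: "a > 0" and l: "l \<in> sphere 0 1"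
    and W: "\<And>z v. z \<in> D \<Longrightarrow> maurer_cartan (Ft l) z v = loop_form A \<alpha> B l z v"
  shows "curvature (Omega Ft a l) z v w = 0"
proof -
  have l0: "l \<noteq> 0" using l by auto
  let ?g = "\<lambda>z v. diag_conj (sqrt a) (loop_form A \<alpha> B (l / of_real (sqrt a)) z v)"
  have eq: "Omega Ft a l x v = ?g x v" if "x \<in> D" for x v
    by (rule Omega_eq_diag_conj[where Ft = Ft and z = x]) (use that in \<open>simp_all add: W l0 a offdiag_A offdiag_B diag_\<alpha>\<close>)
  have diff: "(\<lambda>x. loop_form A \<alpha> B (l / of_real (sqrt a)) x v) differentiable (at z)" for v
    using smooth_on_has_derivative[OF smooth_loop_form z] by (auto simp: differentiable_def)
  have diffg: "(\<lambda>x. ?g x v) differentiable (at z)" for v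
    by (rule differentiable_compose[OF _ diff, unfolded o_def])
       (meson bounded_linear_diag_conj bounded_linear_imp_differentiable)
  have "curvature (Omega Ft a l) z v w = curvature ?g z v w"
    by (rule curvature_cong[OF open_D z, symmetric]) (use eq diffg in auto)
  also have "\<dots> = diag_conj (sqrt a) (curvature (loop_form A \<alpha> B (l / of_real (sqrt a))) z v w)"
    using a by (intro curvature_diag_conj diff) simp
  also have "\<dots> = 0"
    using a l0 flat_punctured_plane[OF z] bounded_linear.linear[OF bounded_linear_diag_conj, THEN linear_0] by simp
  finally show ?thesis .
qed

text \<open>Flatness on the circle holds because the forms are Maurer--Cartan forms of actual frames, and the
  reality conditions because these frames are unitary.\<close>

lemma extended_frame_loop_connection:
  assumes D: "open D" and ext: "extended_frame D N Ft"
  obtains A \<alpha> B where "loop_connection D A B \<alpha>"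
    "\<And>l z v. l \<in> sphere 0 1 \<Longrightarrow> z \<in> D \<Longrightarrow> maurer_cartan (Ft l) z v = loop_form A \<alpha> B l z v"
proof -
  from ext obtain \<alpha>1' \<alpha>0 \<alpha>1'' where
    t10: "is_type_10 D \<alpha>1'" and t01: "is_type_01 D \<alpha>1''"
    and parts: "\<forall>z\<in>D. \<forall>v. offdiag_part (\<alpha>1' z v) = \<alpha>1' z v \<and>
                 diag_part (\<alpha>0 z v) = \<alpha>0 z v \<and> offdiag_part (\<alpha>1'' z v) = \<alpha>1'' z v"
    and mc: "\<forall>l\<in>sphere 0 1. \<forall>z\<in>D. \<forall>v. maurer_cartan (Ft l) z v =
         cscale (inverse l) (\<alpha>1' z v) + \<alpha>0 z v + cscale l (\<alpha>1'' z v)"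
    unfolding extended_frame_def by blast
  have smooth: "smooth_on D (Ft l)" and SU2: "Ft l ` D \<subseteq> SU2" if "l \<in> sphere 0 1" for l
    using ext that by (auto simp: extended_frame_def LambdaSU2_def)
  define A where "A z = \<alpha>1' z 1" for z
  define B where "B z = \<alpha>1'' z 1" for z
  have A: "offdiag_part (A z) = A z" and B: "offdiag_part (B z) = B z"
    and \<alpha>: "diag_part (\<alpha>0 z v) = \<alpha>0 z v" if "z \<in> D" for z v
    using parts that by (auto simp: A_def B_def)
  have W: "maurer_cartan (Ft l) z v = loop_form A \<alpha>0 B l z v" if "l \<in> sphere 0 1" "z \<in> D" for l z v
  proof -
    have "\<alpha>1' z v = cscale v (A z)" "\<alpha>1'' z v = cscale (cnj v) (B z)"
      using t10 t01 that(2) unfolding A_def B_def is_type_10_def is_type_01_def by blast+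
    then show ?thesis using mc that by (simp add: loop_form_def cmat_eq_iff)
  qed
  have one: "(1::complex) \<in> sphere 0 1" by simp
  have smoothW: "smooth_on D (\<lambda>z. maurer_cartan (Ft 1) z v)" for v
    by (rule smooth_on_maurer_cartan_SU2[OF D smooth[OF one] SU2[OF one]])
  have skew: "ctranspose (loop_form A \<alpha>0 B l z v) = - loop_form A \<alpha>0 B l z v"
    if "l \<in> sphere 0 1" "z \<in> D" for l z v
    using maurer_cartan_SU2_skew[OF D smooth[OF that(1)] SU2[OF that(1)] that(2), of v] W[OF that] by simp
  have "loop_connection D A B \<alpha>0"
  proof (rule loop_connection.intro)
    show "open D" by (rule D)
    \<comment> \<open>\<open>A\<close> is the \<open>dz\<close>-component of the off-diagonal part at parameter 1.\<close>
    have "smooth_on D (\<lambda>z. cscale (1/2) (offdiag_part (maurer_cartan (Ft 1) z 1))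
        + cscale (- \<i> / 2) (offdiag_part (maurer_cartan (Ft 1) z \<i>)))"
      by (intro smooth_on_add smooth_on_cscale smooth_on_bounded_linear[OF D bounded_linear_offdiag_part] smoothW D)
    then show "smooth_on D A"
      by (rule smooth_on_transform[OF D, rotated])
         (use A B \<alpha> in \<open>auto simp: W[OF one] loop_form_def cmat_eq_iff offdiag_part_def diag_part_def algebra_simps\<close>)
    have "bounded_linear (\<lambda>X. X - offdiag_part X)"
      by (intro bounded_linear_sub bounded_linear_ident bounded_linear_offdiag_part)
    from smooth_on_bounded_linear[OF D this smoothW]
    show "smooth_on D (\<lambda>z. \<alpha>0 z v)" for v
      by (rule smooth_on_transform[OF D, rotated])
         (use A B \<alpha> in \<open>auto simp: W[OF one] loop_form_def cmat_eq_iff offdiag_part_def diag_part_def algebra_simps\<close>)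
    have zero: "A z $ 1 $ 1 = 0" "A z $ 2 $ 2 = 0" "B z $ 1 $ 1 = 0" "B z $ 2 $ 2 = 0"
      "\<alpha>0 z v $ 1 $ 2 = 0" "\<alpha>0 z v $ 2 $ 1 = 0" if "z \<in> D" for z v
      using A[OF that] B[OF that] \<alpha>[OF that, of v] by (auto simp: cmat_eq_iff offdiag_part_def diag_part_def)
    show "offdiag_part (A z) = A z" if "z \<in> D" for z
      using A that by auto
    show "diag_part (\<alpha>0 z v) = \<alpha>0 z v" if "z \<in> D" for z v
      using \<alpha> that by auto
    have i: "\<i> \<in> sphere 0 1" by simp
    show "B z = - ctranspose (A z)" if "z \<in> D" for z
    proof -
      \<comment> \<open>Skewness at the parameters \<open>1\<close> and \<open>\<i>\<close> says that \<open>B + A\<^sup>*\<close> plus, respectively minus, its adjoint vanishes.\<close>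
      have *: "r = - x" if "x + y = - p - r" "\<i> * x - \<i> * y = \<i> * p - \<i> * r" for x y p r :: complex
      proof -
        have "x - y = p - r" using that(2) by (simp flip: right_diff_distrib)
        with that(1) have "2 * (r + x) = 0" by algebra
        then have "r + x = 0" by (metis mult_eq_0_iff zero_neq_numeral)
        then show ?thesis by (simp add: eq_neg_iff_add_eq_0)
      qed
      show ?thesis
        using skew[OF one that, of 1] skew[OF i that, of 1]
        by (auto simp: cmat_eq_iff loop_form_def zero that intro: *)
    qed
    show "ctranspose (\<alpha>0 z v) = - \<alpha>0 z v" if "z \<in> D" for z v
      using skew[OF one that, of v] by (simp add: cmat_eq_iff loop_form_def zero that)
  next
    fix z l v w assume z: "z \<in> D" and l: "l \<in> sphere (0::complex) 1"
    have s: "smooth_on D (\<lambda>z. maurer_cartan (Ft l) z v)" for v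
      by (rule smooth_on_maurer_cartan_SU2[OF D smooth[OF l] SU2[OF l]])
    have "curvature (loop_form A \<alpha>0 B l) z v w = curvature (maurer_cartan (Ft l)) z v w"
      by (rule curvature_cong[OF D z, symmetric])
         (use W[OF l] smooth_on_has_derivative[OF s z] in \<open>auto simp: differentiable_def\<close>)
    also have "\<dots> = 0"
      using SU2[OF l] SU2_subset_SL2C by (intro curvature_maurer_cartan[OF D smooth[OF l] _ z s]) auto
    finally show "curvature (loop_form A \<alpha>0 B l) z v w = 0" .
  qed
  then show ?thesis using that W by blast
qed

section \<open>Congruence by a frame\<close>

lemma mink_congruence:
  assumes "det P = 1"
  shows "mink (P ** X ** ctranspose P) (P ** Y ** ctranspose P) = mink X Y"
proof -
  have "P ** X ** ctranspose P + P ** Y ** ctranspose P = P ** (X + Y) ** ctranspose P"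
    by (simp add: matrix_add_ldistrib bounded_bilinear.add_left[OF bounded_bilinear_cmat_mult])
  then show ?thesis using assms by (simp add: mink_def det_mul det_ctranspose)
qed

text \<open>The quadratic form of \<open>P P\<^sup>*\<close> at \<open>v\<close> is \<open>\<bar>P\<^sup>* v\<bar>\<^sup>2\<close>, and \<open>P\<^sup>*\<close> is invertible.\<close>

lemma mult_ctranspose_in_H3:
  assumes "P \<in> SL2C" shows "P ** ctranspose P \<in> H3"
proof -
  have det: "P$1$1 * P$2$2 - P$1$2 * P$2$1 = 1" using assms by (simp add: SL2C_def det_2)
  have pos: "0 < Re (\<Sum>i\<in>UNIV. \<Sum>j\<in>UNIV. cnj (v $ i) * (P ** ctranspose P) $ i $ j * v $ j)" if v: "v \<noteq> 0" for v
  proof -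
    \<comment> \<open>\<open>x\<close> and \<open>y\<close> are the components of \<open>P\<^sup>* v\<close>.\<close>
    define x where "x = cnj (P$1$1) * v$1 + cnj (P$2$1) * v$2"
    define y where "y = cnj (P$1$2) * v$1 + cnj (P$2$2) * v$2"
    have dc: "cnj (P$1$1) * cnj (P$2$2) - cnj (P$1$2) * cnj (P$2$1) = 1"
      using arg_cong[OF det, of cnj] by simp
    have "v$1 = cnj (P$2$2) * x - cnj (P$2$1) * y" "v$2 = cnj (P$1$1) * y - cnj (P$1$2) * x"
      using dc unfolding x_def y_def by algebra+
    then have "x \<noteq> 0 \<or> y \<noteq> 0" using v by (auto simp: vec_eq_iff forall_2)
    moreover have "(\<Sum>i\<in>UNIV. \<Sum>j\<in>UNIV. cnj (v $ i) * (P ** ctranspose P) $ i $ j * v $ j) = x * cnj x + y * cnj y"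
      by (simp add: sum_2 x_def y_def algebra_simps)
    moreover have "Re (x * cnj x) = (cmod x)\<^sup>2" for x
      unfolding cmod_power2 by (simp add: power2_eq_square)
    ultimately show ?thesis
      by (auto simp: add_pos_nonneg add_nonneg_pos)
  qed
  have "ctranspose (ctranspose P) = P" by (simp add: cmat_eq_iff)
  then have "hermitian (P ** ctranspose P)" by (simp add: hermitian_def ctranspose_mult)
  moreover have "det (P ** ctranspose P) = 1"
    using assms by (simp add: det_mul det_ctranspose SL2C_def)
  ultimately show ?thesis using pos by (simp add: H3_def)
qed

text \<open>All maps met below (the harmonic map, the surface, and its \<open>z\<close>-derivative) have the form
  \<open>F X F\<^sup>*\<close>; in each case only the bracketed middle factor of the derivative matters, as
  \<open>mink_congruence\<close> discards the frame.\<close>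

lemma has_derivative_congruence:
  fixes F X :: "complex \<Rightarrow> cmat"
  assumes F: "(F has_derivative (\<lambda>v. F z ** W v)) (at z)" and X: "(X has_derivative X') (at z)"
  shows "((\<lambda>x. F x ** X x ** ctranspose (F x)) has_derivative
    (\<lambda>v. F z ** (W v ** X z + X' v + X z ** ctranspose (W v)) ** ctranspose (F z))) (at z)"
proof -
  have "((\<lambda>x. F x ** X x ** ctranspose (F x)) has_derivative
    (\<lambda>v. F z ** X z ** ctranspose (F z ** W v) + (F z ** X' v + F z ** W v ** X z) ** ctranspose (F z))) (at z)"
    by (rule has_derivative_cmat_mult[OF has_derivative_cmat_mult[OF F X]
        bounded_linear.has_derivative[OF bounded_linear_ctranspose F]])
  moreover have "F z ** X z ** ctranspose (F z ** W v) + (F z ** X' v + F z ** W v ** X z) ** ctranspose (F z)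
    = F z ** (W v ** X z + X' v + X z ** ctranspose (W v)) ** ctranspose (F z)" for v
    by (simp add: ctranspose_mult matrix_mul_assoc matrix_add_ldistrib
        bounded_bilinear.add_left[OF bounded_bilinear_cmat_mult] add_ac)
  ultimately show ?thesis by simp
qed

lemma cmat_mult_comb:
  "cscale k (P ** X ** Q + cscale c (P ** Y ** Q)) = P ** cscale k (X + cscale c Y) ** Q"
  "cscale k (P ** X ** Q - cscale c (P ** Y ** Q)) = P ** cscale k (X - cscale c Y) ** Q" for P Q X Y :: cmat
  by (simp_all add: cmat_eq_iff algebra_simps)

lemma d_z_congruence:
  assumes "\<And>v. frechet_derivative f (at z) v = P ** M v ** Q"
  shows "d_z f z = P ** cscale (1/2) (M 1 - cscale \<i> (M \<i>)) ** Q"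
    "d_zbar f z = P ** cscale (1/2) (M 1 + cscale \<i> (M \<i>)) ** Q"
  unfolding d_z_def d_zbar_def assms cmat_mult_comb by simp_all

section \<open>The product of the entries and its zeros\<close>

lemma field_derivative_if_commutes_with_i:
  assumes "(h has_derivative h') (at z)" "h' \<i> = \<i> * h' 1"
  shows "(h has_field_derivative h' 1) (at z)"
proof -
  have lin: "linear h'" using assms(1) by (rule has_derivative_linear)
  have "h' v = h' 1 * v" for v
  proof -
    have "h' v = h' (Re v *\<^sub>R 1 + Im v *\<^sub>R \<i>)"
      by (rule arg_cong[of _ _ h']) (simp add: complex_eq_iff)
    also have "\<dots> = Re v *\<^sub>R h' 1 + Im v *\<^sub>R h' \<i>"
      using lin by (simp only: linear_add linear_scale)
    also have "\<dots> = h' 1 * (of_real (Re v) + \<i> * of_real (Im v))"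
      using assms(2) by (simp add: scaleR_conv_of_real algebra_simps)
    finally show ?thesis by (simp flip: complex_eq)
  qed
  then have "h' = (*) (h' 1)" by (rule ext)
  then show ?thesis using assms(1) by (simp add: has_field_derivative_def)
qed

text \<open>If \<open>x, y\<close> and \<open>x', y'\<close> are the derivatives of \<open>p, q\<close> in the directions \<open>1\<close> and \<open>\<i>\<close>, the hypotheses are
  Cauchy--Riemann equations with zero-order terms of opposite sign; these cancel in the Leibniz rule
  and leave the Cauchy--Riemann equation of \<open>p q\<close>.\<close>

lemma opposite_weights_product:
  fixes x y x' y' p q k :: complex
  assumes "\<i> * x - x' + k * p = 0" "\<i> * y - y' - k * q = 0"
  shows "p * y' + x' * q = \<i> * (p * y + x * q)"
proof -
  have x': "x' = \<i> * x + k * p" using assms(1) by (simp add: algebra_simps)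
  have y': "y' = \<i> * y - k * q" using assms(2) by (simp add: algebra_simps)
  show ?thesis unfolding x' y' by (simp add: algebra_simps)
qed

context loop_connection
begin

abbreviation p where "p z \<equiv> A z $ 1 $ 2"
abbreviation q where "q z \<equiv> A z $ 2 $ 1"

lemma entries:
  assumes "z \<in> D"
  shows "A z $ 1 $ 1 = 0" "A z $ 2 $ 2 = 0" "B z $ 1 $ 1 = 0" "B z $ 2 $ 2 = 0"
    "B z $ 1 $ 2 = - cnj (q z)" "B z $ 2 $ 1 = - cnj (p z)"
    "\<alpha> z v $ 1 $ 2 = 0" "\<alpha> z v $ 2 $ 1 = 0"
    "cnj (\<alpha> z v $ 1 $ 1) = - \<alpha> z v $ 1 $ 1" "cnj (\<alpha> z v $ 2 $ 2) = - \<alpha> z v $ 2 $ 2"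
proof -
  show A: "A z $ 1 $ 1 = 0" "A z $ 2 $ 2 = 0"
    using offdiag_A[OF assms] by (auto simp: cmat_eq_iff offdiag_part_def)
  show "\<alpha> z v $ 1 $ 2 = 0" "\<alpha> z v $ 2 $ 1 = 0"
    using diag_\<alpha>[OF assms, of v] by (auto simp: cmat_eq_iff diag_part_def)
  show "B z $ 1 $ 1 = 0" "B z $ 2 $ 2 = 0" "B z $ 1 $ 2 = - cnj (q z)" "B z $ 2 $ 1 = - cnj (p z)"
    by (simp_all add: B_eq[OF assms] A)
  have "ctranspose (\<alpha> z v) $ i $ i = - \<alpha> z v $ i $ i" for i
    using skew_\<alpha>[OF assms, of v] by (simp del: ctranspose_nth)
  then show "cnj (\<alpha> z v $ 1 $ 1) = - \<alpha> z v $ 1 $ 1" "cnj (\<alpha> z v $ 2 $ 2) = - \<alpha> z v $ 2 $ 2"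
    by simp_all
qed

text \<open>The diagonal form \<open>\<alpha>\<close> acts by commutator on the two off-diagonal entries of \<open>A\<close> with opposite
  weights, so it drops out of the \<open>l\<^sup>-\<^sup>1\<close>-part of the flatness equation for \<open>p q\<close>.\<close>

lemma product_holomorphic: "(\<lambda>z. p z * q z) holomorphic_on D"
proof -
  have "\<exists>d. ((\<lambda>z. p z * q z) has_field_derivative d) (at z)" if z: "z \<in> D" for z
  proof -
    let ?A' = "frechet_derivative A (at z)"
    have A': "(A has_derivative ?A') (at z)" by (rule smooth_on_has_derivative[OF smooth_A z])
    have nth: "((\<lambda>z. A z $ i $ j) has_derivative (\<lambda>v. ?A' v $ i $ j)) (at z)" for i j
      by (rule bounded_linear.has_derivative[OF bounded_linear_cmat_nth A'])
    have h: "((\<lambda>z. p z * q z) has_derivative (\<lambda>v. p z * ?A' v $ 2 $ 1 + ?A' v $ 1 $ 2 * q z)) (at z)"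
      by (rule has_derivative_mult[OF nth nth])
    let ?\<kappa> = "\<lambda>v. \<alpha> z v $ 1 $ 1 - \<alpha> z v $ 2 $ 2"
    have c: "coeff_minus z 1 \<i> $ 1 $ 2 = \<i> * ?A' 1 $ 1 $ 2 - ?A' \<i> $ 1 $ 2 + (\<i> * ?\<kappa> 1 - ?\<kappa> \<i>) * p z"
      "coeff_minus z 1 \<i> $ 2 $ 1 = \<i> * ?A' 1 $ 2 $ 1 - ?A' \<i> $ 2 $ 1 - (\<i> * ?\<kappa> 1 - ?\<kappa> \<i>) * q z"
      by (simp_all add: coeff_minus_def commutator_def entries[OF z] algebra_simps)
    have e: "\<i> * ?A' 1 $ 1 $ 2 - ?A' \<i> $ 1 $ 2 + (\<i> * ?\<kappa> 1 - ?\<kappa> \<i>) * p z = 0"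
      "\<i> * ?A' 1 $ 2 $ 1 - ?A' \<i> $ 2 $ 1 - (\<i> * ?\<kappa> 1 - ?\<kappa> \<i>) * q z = 0"
      using coefficients_vanish(1)[OF z, of 1 \<i>] by (simp_all flip: c)
    have "((\<lambda>z. p z * q z) has_field_derivative (p z * ?A' 1 $ 2 $ 1 + ?A' 1 $ 1 $ 2 * q z)) (at z)"
      by (rule field_derivative_if_commutes_with_i[OF h opposite_weights_product[OF e]])
    then show ?thesis by blast
  qed
  then show ?thesis by (simp add: holomorphic_on_open[OF open_D])
qed

text \<open>An accumulation point of zeros of \<open>q\<close> in \<open>D\<close> would be one of zeros of the holomorphic function
  \<open>p q\<close>, against the identity theorem.\<close>

lemma discrete_zeros_q:
  assumes "connected D" "z0 \<in> D" "p z0 * q z0 \<noteq> 0"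
  shows "discrete {z \<in> D. q z = 0}"
proof (rule discreteI)
  fix z assume z: "z \<in> {z \<in> D. q z = 0}"
  have "\<not> z islimpt {z \<in> D. q z = 0}"
  proof
    assume limpt: "z islimpt {z \<in> D. q z = 0}"
    have "p z0 * q z0 = 0"
    proof (rule analytic_continuation[where f = "\<lambda>z. p z * q z" and S = D and U = "{z \<in> D. q z = 0}" and \<xi> = z])
      show "z islimpt {z \<in> D. q z = 0}" by (rule limpt)
    qed (use z assms product_holomorphic open_D in auto)
    with assms(3) show False by simp
  qed
  with z show "z isolated_in {z \<in> D. q z = 0}" by (simp add: isolated_in_islimpt_iff)
qed

end

section \<open>The surface in hyperbolic space\<close>

locale deformed_frame = loop_connection +
  fixes a :: real and \<theta> :: complex and F :: "complex \<Rightarrow> cmat"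
  assumes a_pos: "a > 0" and a_ne_1: "a \<noteq> 1" and theta: "\<theta> \<in> sphere 0 1"
    and F_SL2C: "\<And>z. z \<in> D \<Longrightarrow> F z \<in> SL2C"
    and F_diff: "\<And>z. z \<in> D \<Longrightarrow> F differentiable (at z)"
    and F_frame: "\<And>z v. z \<in> D \<Longrightarrow> maurer_cartan F z v
       = diag_conj (sqrt a) (loop_form A \<alpha> B (\<theta> / of_real (sqrt a)) z v)"
begin

definition \<Omega> :: form1 where
  "\<Omega> z v = diag_conj (sqrt a) (loop_form A \<alpha> B (\<theta> / of_real (sqrt a)) z v)"

definition c :: real where "c = a - inverse a"

definition f where "f = (\<lambda>z. F z ** ctranspose (F z))"
definition Nf where "Nf = (\<lambda>z. - (F z ** \<sigma>3 ** ctranspose (F z)))"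

lemma c_ne_0: "c \<noteq> 0"
proof
  assume "c = 0"
  then have "a * a = 1" using a_pos by (simp add: c_def field_simps)
  then show False using a_pos a_ne_1 by (metis abs_of_pos abs_one real_sqrt_abs2 real_sqrt_one)
qed

lemma theta_cnj: "\<theta> * cnj \<theta> = 1" "inverse \<theta> = cnj \<theta>"
proof -
  show 1: "\<theta> * cnj \<theta> = 1" using theta by (metis complex_norm_square mem_sphere_0 of_real_1 power_one)
  then show "inverse \<theta> = cnj \<theta>" by (rule inverse_unique)
qed

lemma Omega_entries:
  assumes z: "z \<in> D"
  shows "\<Omega> z v $ 1 $ 1 = \<alpha> z v $ 1 $ 1" "\<Omega> z v $ 2 $ 2 = \<alpha> z v $ 2 $ 2"
    "\<Omega> z v $ 1 $ 2 = cnj \<theta> * v * p z - of_real (inverse a) * \<theta> * cnj v * cnj (q z)"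
    "\<Omega> z v $ 2 $ 1 = of_real a * cnj \<theta> * v * q z - \<theta> * cnj v * cnj (p z)"
proof -
  define s where "s = complex_of_real (sqrt a)"
  have s: "s * s = of_real a" "s \<noteq> 0" using a_pos by (simp_all add: s_def flip: of_real_mult)
  have th: "\<theta> \<noteq> 0" using theta by auto
  have nz: "sqrt a \<noteq> 0" using a_pos by simp
  note d = diag_conj_nth[OF nz] s_def[symmetric]
  show "\<Omega> z v $ 1 $ 1 = \<alpha> z v $ 1 $ 1" "\<Omega> z v $ 2 $ 2 = \<alpha> z v $ 2 $ 2"
    by (simp_all add: \<Omega>_def d loop_form_def entries[OF z])
  show "\<Omega> z v $ 1 $ 2 = cnj \<theta> * v * p z - of_real (inverse a) * \<theta> * cnj v * cnj (q z)"
    "\<Omega> z v $ 2 $ 1 = of_real a * cnj \<theta> * v * q z - \<theta> * cnj v * cnj (p z)"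
    unfolding \<Omega>_def of_real_inverse s(1)[symmetric] theta_cnj(2)[symmetric]
    using s(2) th by (simp_all add: d loop_form_def entries[OF z] field_simps)
qed

text \<open>Unitarity of the undeformed frame is what cancels \<open>\<alpha>\<close> and \<open>p\<close>; the entry \<open>q\<close> survives since the
  deformation scales it by \<open>a\<close> in the \<open>(1,0)\<close>-part and by \<open>a\<^sup>-\<^sup>1\<close> in the \<open>(0,1)\<close>-part.\<close>

lemma Omega_hermitian_part:
  assumes z: "z \<in> D"
  shows "\<Omega> z v + ctranspose (\<Omega> z v) =
    vector [vector [0, of_real c * \<theta> * cnj v * cnj (q z)], vector [of_real c * cnj \<theta> * v * q z, 0]]"
  by (simp add: cmat_eq_iff Omega_entries[OF z] entries[OF z] c_def algebra_simps)

lemma smooth_Omega: "smooth_on D (\<lambda>z. \<Omega> z v)"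
  unfolding \<Omega>_def by (intro smooth_on_bounded_linear[OF open_D bounded_linear_diag_conj] smooth_loop_form)

lemma F_has_derivative:
  assumes z: "z \<in> D"
  shows "(F has_derivative (\<lambda>v. F z ** \<Omega> z v)) (at z)"
proof -
  have "frechet_derivative F (at z) = (\<lambda>v. F z ** \<Omega> z v)"
    by (simp add: frechet_derivative_eq_mult_maurer_cartan[where F = F and z = z, OF F_SL2C[OF z]]
        F_frame[OF z] \<Omega>_def fun_eq_iff)
  then show ?thesis using F_diff[OF z] by (simp add: frechet_derivative_works)
qed

text \<open>Bootstrapping in \<open>dF = F \<Omega>\<close>: if \<open>F\<close> is of class \<open>C\<^sup>k\<close>, so is \<open>dF\<close>.\<close>

lemma smooth_F: "smooth_on D F"
proof -
  have "Ck_on k D F" for k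
  proof (induction k)
    case 0
    show ?case by (auto intro!: continuous_at_imp_continuous_on differentiable_imp_continuous_within F_diff)
  next
    case (Suc k)
    have "Ck_on k D (\<lambda>z. F z ** \<Omega> z v)" for v
      using smooth_Omega[of v] unfolding smooth_on_def by (intro Ck_on_mult[OF open_D] Suc) blast
    from Ck_on_SucI[OF open_D F_has_derivative this] show ?case .
  qed
  then show ?thesis by (simp add: smooth_on_def)
qed

lemma det_F: "z \<in> D \<Longrightarrow> det (F z) = 1" using F_SL2C by (simp add: SL2C_def)

lemma smooth_f: "smooth_on D f"
  unfolding f_def by (intro smooth_on_mult smooth_on_ctranspose smooth_F open_D)

lemma Nf_eq: "Nf z = F z ** (- \<sigma>3) ** ctranspose (F z)"
  by (simp add: Nf_def cmat_eq_iff algebra_simps)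

lemma smooth_Nf: "smooth_on D Nf"
proof -
  have "smooth_on D (\<lambda>z. F z ** (- \<sigma>3))"
    by (rule smooth_on_bounded_linear[OF open_D bounded_bilinear.bounded_linear_left[OF bounded_bilinear_cmat_mult] smooth_F])
  from smooth_on_mult[OF open_D this smooth_on_ctranspose[OF open_D smooth_F]]
  show ?thesis unfolding Nf_eq[abs_def] .
qed

lemma df:
  assumes "z \<in> D"
  shows "frechet_derivative f (at z) v = F z ** (\<Omega> z v + ctranspose (\<Omega> z v)) ** ctranspose (F z)"
proof -
  have "f = (\<lambda>z. F z ** mat 1 ** ctranspose (F z))" by (simp add: f_def)
  then show ?thesis
    using frechet_derivative_eqI[OF has_derivative_congruence[OF F_has_derivative[OF assms] has_derivative_const[of "mat 1"]]]
    by simp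
qed

lemma metric:
  assumes "z \<in> D"
  shows "mink (frechet_derivative f (at z) v) (frechet_derivative f (at z) w)
    = of_real (c\<^sup>2 * (cmod (q z))\<^sup>2 * (v \<bullet> w))"
proof -
  have "mink (frechet_derivative f (at z) v) (frechet_derivative f (at z) w)
    = of_real c * of_real c * (\<theta> * cnj \<theta>) * (q z * cnj (q z)) * ((v * cnj w + cnj v * w) / 2)"
    unfolding df[OF assms] mink_congruence[OF det_F[OF assms]] Omega_hermitian_part[OF assms]
    by (simp add: mink_def det_2 field_simps)
  also have "(v * cnj w + cnj v * w) / 2 = of_real (v \<bullet> w)"
    by (simp add: complex_eq_iff inner_complex_def)
  finally show ?thesis
    unfolding theta_cnj(1) unfolding complex_norm_square[symmetric] by (simp add: power2_eq_square)
qed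

text \<open>By \<open>metric\<close> the differential is injective where \<open>q \<noteq> 0\<close>, and where \<open>q = 0\<close> it is zero.\<close>

lemma singular_set_eq: "singular_set D f = {z \<in> D. q z = 0}"
proof -
  have "inj (frechet_derivative f (at z)) \<longleftrightarrow> q z \<noteq> 0" if z: "z \<in> D" for z
  proof
    assume "inj (frechet_derivative f (at z))"
    then have "frechet_derivative f (at z) 1 \<noteq> frechet_derivative f (at z) 0" by (auto dest: injD)
    then show "q z \<noteq> 0" by (auto simp: df[OF z] Omega_hermitian_part[OF z])
  next
    assume q: "q z \<noteq> 0"
    have "linear (frechet_derivative f (at z))"
      by (rule has_derivative_linear[OF smooth_on_has_derivative[OF smooth_f z]])
    moreover have "v = 0" if "frechet_derivative f (at z) v = 0" for v
    proof -
      have "complex_of_real (c\<^sup>2 * (cmod (q z))\<^sup>2 * (v \<bullet> v)) = 0"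
        using metric[OF z, of v v] that by (simp add: mink_def det_2)
      then show "v = 0" using q c_ne_0 by (simp only: of_real_eq_0_iff) simp
    qed
    ultimately show "inj (frechet_derivative f (at z))" by (simp add: linear_injective_0)
  qed
  then show ?thesis by (auto simp: singular_set_def)
qed

definition u where "u z = ln (c\<^sup>2 * (cmod (q z))\<^sup>2) / 2"

lemma exp_u: "q z \<noteq> 0 \<Longrightarrow> exp (2 * u z) = c\<^sup>2 * (cmod (q z))\<^sup>2"
  using c_ne_0 by (simp add: u_def)

lemma conformal:
  assumes "connected D" "z0 \<in> D" "p z0 * q z0 \<noteq> 0"
  shows "conformal_immersion_isolated_singularities D f u"
  unfolding conformal_immersion_isolated_singularities_def singular_set_eq
proof (intro conjI ballI allI)
  show "f ` D \<subseteq> H3" using mult_ctranspose_in_H3[OF F_SL2C] by (auto simp: f_def)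
  show "mink (frechet_derivative f (at z) v) (frechet_derivative f (at z) w)
    = complex_of_real (exp (2 * u z) * (v \<bullet> w))" if "z \<in> D - {z \<in> D. q z = 0}" for z v w
  proof -
    have "z \<in> D" "q z \<noteq> 0" using that by auto
    then show ?thesis by (simp only: metric exp_u not_False_eq_True)
  qed
qed (rule smooth_f discrete_zeros_q[OF assms])+

text \<open>After removing the frame, the position is \<open>1\<close>, the normal is \<open>- \<sigma>3\<close> and the tangent vectors are
  off-diagonal Hermitian matrices; \<open>\<sigma>3\<close> is orthogonal to both in Minkowski space.\<close>

lemma normal: "unit_normal_field (D - singular_set D f) f Nf"
proof -
  have "smooth_on (D - singular_set D f) Nf" by (rule smooth_on_subset[OF smooth_Nf]) auto
  moreover have "hermitian (Nf z)" for z
    by (simp add: hermitian_def Nf_def cmat_eq_iff \<sigma>3_def algebra_simps)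
  moreover have "mink (Nf z) (Nf z) = 1" if "z \<in> D" for z
    unfolding Nf_eq mink_congruence[OF det_F[OF that]] by (simp add: mink_def det_2 \<sigma>3_def)
  moreover have "mink (Nf z) (f z) = 0" if "z \<in> D" for z
  proof -
    have "f z = F z ** mat 1 ** ctranspose (F z)" by (simp add: f_def)
    then show ?thesis
      unfolding Nf_eq by (simp only: mink_congruence[OF det_F[OF that]]) (simp add: mink_def det_2 \<sigma>3_def mat_def)
  qed
  moreover have "mink (Nf z) (frechet_derivative f (at z) v) = 0" if "z \<in> D" for z v
    unfolding Nf_eq df[OF that] mink_congruence[OF det_F[OF that]] Omega_hermitian_part[OF that]
    by (simp add: mink_def det_2 \<sigma>3_def algebra_simps)
  ultimately show ?thesis by (auto simp: unit_normal_field_def)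
qed

text \<open>The middle factor of \<open>f\<^sub>z\<close>, as a function of \<open>A\<close>.\<close>

definition lower :: "cmat \<Rightarrow> cmat" where
  "lower X = vector [vector [0, 0], vector [of_real c * cnj \<theta> * X $ 2 $ 1, 0]]"

lemma bounded_linear_lower: "bounded_linear lower"
  by (rule linear_conv_bounded_linear[THEN iffD1])
     (auto simp: cmat_eq_iff lower_def algebra_simps intro!: linearI)

lemma d_z_f:
  assumes "z \<in> D"
  shows "d_z f z = F z ** lower (A z) ** ctranspose (F z)"
  unfolding d_z_congruence(1)[of f z, OF df[OF assms]] Omega_hermitian_part[OF assms]
  by (rule arg_cong[where f = "\<lambda>X. F z ** X ** ctranspose (F z)"]) (simp add: cmat_eq_iff lower_def algebra_simps)

text \<open>Pairing with \<open>\<sigma>3\<close> only sees the difference of the diagonal entries of the middle factor of \<open>\<partial>\<^sup>2f/\<partial>z\<partial>zbar\<close>.  The derivative of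
  \<open>lower A\<close> is off-diagonal and does not contribute.  The two remaining products contribute
  \<open>- c \<bar>q\<bar>\<^sup>2 / a\<close> at the upper and \<open>c a \<bar>q\<bar>\<^sup>2\<close> at the lower diagonal place.\<close>

lemma mean_curvature:
  "has_mean_curvature (D - singular_set D f) f u Nf (\<lambda>z. (a\<^sup>2 + 1) / (a\<^sup>2 - 1))"
proof -
  have "mink (d_zbar (d_z f) z) (Nf z) = complex_of_real (1/2 * ((a\<^sup>2 + 1) / (a\<^sup>2 - 1)) * exp (2 * u z))"
    if z: "z \<in> D" and q: "q z \<noteq> 0" for z
  proof -
    have "((\<lambda>x. F x ** lower (A x) ** ctranspose (F x)) has_derivative
      (\<lambda>v. F z ** (\<Omega> z v ** lower (A z) + lower (frechet_derivative A (at z) v)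
         + lower (A z) ** ctranspose (\<Omega> z v)) ** ctranspose (F z))) (at z)"
      by (intro has_derivative_congruence F_has_derivative z bounded_linear.has_derivative[OF bounded_linear_lower]
         smooth_on_has_derivative[OF smooth_A z])
    then have "(d_z f has_derivative
      (\<lambda>v. F z ** (\<Omega> z v ** lower (A z) + lower (frechet_derivative A (at z) v)
         + lower (A z) ** ctranspose (\<Omega> z v)) ** ctranspose (F z))) (at z)"
      by (rule has_derivative_transform_within_open[OF _ open_D z]) (simp add: d_z_f)
    note d = d_z_congruence(2)[of "d_z f" z, OF fun_cong[OF frechet_derivative_eqI[OF this]]]
    have "mink (d_zbar (d_z f) z) (Nf z)
       = 1/2 * of_real (c * (a + inverse a)) * (\<theta> * cnj \<theta>) * (q z * cnj (q z))"
      unfolding d Nf_eq mink_congruence[OF det_F[OF z]]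
      by (simp add: mink_def det_2 \<sigma>3_def lower_def Omega_entries[OF z] entries[OF z]) (simp add: field_simps)
    also have "\<dots> = of_real (1/2 * (c * (a + inverse a)) * (cmod (q z))\<^sup>2)"
      unfolding theta_cnj(1) unfolding complex_norm_square[symmetric] by simp
    also have "c * (a + inverse a) = (a\<^sup>2 + 1) / (a\<^sup>2 - 1) * c\<^sup>2"
    proof -
      have "a\<^sup>2 - 1 = a * c" using a_pos by (simp add: c_def power2_eq_square field_simps)
      moreover have "a\<^sup>2 + 1 = a * (a + inverse a)" using a_pos by (simp add: power2_eq_square field_simps)
      ultimately show ?thesis using a_pos c_ne_0 by (simp add: power2_eq_square)
    qed
    finally show ?thesis by (simp add: exp_u[OF q] mult_ac)
  qed
  then show ?thesis by (auto simp: has_mean_curvature_def singular_set_eq)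
qed

end

section \<open>Surfaces of constant mean curvature from harmonic maps\<close>

text \<open>The harmonic map is \<open>F \<sigma>3 F\<^sup>*\<close>, so its \<open>z\<close>-derivative has the middle factor \<open>[A, \<sigma>3]\<close>, which is
  off-diagonal with entries \<open>- 2 p\<close> and \<open>2 q\<close>.\<close>

lemma hopf_differential_frame:
  assumes D: "open D" and ext: "extended_frame D N Ft" and z: "z \<in> D"
    and "loop_connection D A B \<alpha>"
    and W: "\<And>z v. z \<in> D \<Longrightarrow> maurer_cartan (Ft 1) z v = loop_form A \<alpha> B 1 z v"
  shows "hopf_differential N z = - 4 * (A z $ 1 $ 2 * A z $ 2 $ 1)"
proof -
  interpret loop_connection D A B \<alpha> by fact
  have one: "(1::complex) \<in> sphere 0 1" by simp
  have SU2: "Ft 1 x \<in> SU2" if "x \<in> D" for x using ext that one by (auto simp: extended_frame_def LambdaSU2_def)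
  have sm: "smooth_on D (Ft 1)" using ext one unfolding extended_frame_def by blast
  have "Ft 1 z \<in> SL2C" using SU2[OF z] SU2_subset_SL2C by auto
  then have eq: "frechet_derivative (Ft 1) (at z) = (\<lambda>v. Ft 1 z ** loop_form A \<alpha> B 1 z v)"
    by (simp add: fun_eq_iff frechet_derivative_eq_mult_maurer_cartan[where F = "Ft 1" and z = z] W[OF z])
  have F': "(Ft 1 has_derivative (\<lambda>v. Ft 1 z ** loop_form A \<alpha> B 1 z v)) (at z)"
    using smooth_on_has_derivative[OF sm z] unfolding eq .
  have proj: "Ft 1 x ** \<sigma>3 ** ctranspose (Ft 1 x) = N x" if "x \<in> D" for x
  proof -
    have "S2_proj (Ft 1 x) = N x" using ext that unfolding extended_frame_def by blast
    then show ?thesis by (simp add: S2_proj_def SU2_inv(1)[OF SU2[OF that]])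
  qed
  have "(N has_derivative (\<lambda>v. Ft 1 z ** (loop_form A \<alpha> B 1 z v ** \<sigma>3 + 0 + \<sigma>3 ** ctranspose (loop_form A \<alpha> B 1 z v)) ** ctranspose (Ft 1 z))) (at z)"
    by (rule has_derivative_transform_within_open[OF has_derivative_congruence[OF F' has_derivative_const[of \<sigma>3]] D z])
       (rule proj)
  note d = d_z_congruence(1)[of N z, OF fun_cong[OF frechet_derivative_eqI[OF this]]]
  have "det (Ft 1 z) = 1" using SU2[OF z] by (simp add: SU2_def)
  then show ?thesis
    unfolding hopf_differential_def d
    by (simp only: mink_congruence) (simp add: mink_self det_2 loop_form_def \<sigma>3_def entries[OF z] algebra_simps)
qed

theorem theorem4:
  fixes D :: "complex set"
    and N :: "complex \<Rightarrow> cmat"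
    and Ft :: "complex \<Rightarrow> complex \<Rightarrow> cmat"
    and a :: real
    and \<theta> :: complex
  assumes "open D" and "simply_connected D" and "0 \<in> D"
    and "harmonic_map_S2 D N" and "non_conformal D N"
    and "extended_frame D N Ft"
    and "a > 0"
    and "\<theta> \<in> sphere 0 1"
  shows "(\<forall>z\<in>D. \<forall>v w. ext_deriv (Omega Ft a \<theta>) z v w +
             (1/2) *\<^sub>R bracket_wedge (Omega Ft a \<theta>) (Omega Ft a \<theta>) z v w = 0)
       \<and> (a \<noteq> 1 \<longrightarrow>
           (\<forall>F :: complex \<Rightarrow> cmat.
             F ` D \<subseteq> SL2C \<and> F differentiable_on D \<and>
             (\<forall>z\<in>D. \<forall>v. maurer_cartan F z v = Omega Ft a \<theta> z v) \<longrightarrow>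
             (let f = (\<lambda>z. F z ** ctranspose (F z));
                  Nf = (\<lambda>z. - (F z ** \<sigma>3 ** ctranspose (F z)));
                  U = D - singular_set D f
              in \<exists>u. conformal_immersion_isolated_singularities D f u \<and>
                     unit_normal_field U f Nf \<and>
                     has_mean_curvature U f u Nf (\<lambda>z. (a\<^sup>2 + 1) / (a\<^sup>2 - 1)))))"
proof (intro conjI impI allI ballI)
  obtain A \<alpha> B where conn: "loop_connection D A B \<alpha>"
    and W: "\<And>l z v. l \<in> sphere 0 1 \<Longrightarrow> z \<in> D \<Longrightarrow> maurer_cartan (Ft l) z v = loop_form A \<alpha> B l z v"
    by (rule extended_frame_loop_connection[OF assms(1,6)]) (rule that)
  interpret loop_connection D A B \<alpha> by (rule conn)
  show "ext_deriv (Omega Ft a \<theta>) z v w + (1/2) *\<^sub>R bracket_wedge (Omega Ft a \<theta>) (Omega Ft a \<theta>) z v w = 0"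
    if "z \<in> D" for z v w
    using curvature_Omega[where Ft = Ft and l = \<theta>, OF that assms(7,8) W[OF assms(8)], of v w] unfolding curvature_def .
  fix F assume a: "a \<noteq> 1" and F: "F ` D \<subseteq> SL2C \<and> F differentiable_on D \<and>
             (\<forall>z\<in>D. \<forall>v. maurer_cartan F z v = Omega Ft a \<theta> z v)"
  interpret deformed_frame D A B \<alpha> a \<theta> F
  proof (rule deformed_frame.intro[OF conn], rule deformed_frame_axioms.intro)
    show "a > 0" "a \<noteq> 1" "\<theta> \<in> sphere 0 1" by (fact assms(7) a assms(8))+
    show "F z \<in> SL2C" if "z \<in> D" for z using F that by blast
    show "F differentiable (at z)" if "z \<in> D" for z
      using F assms(1) that differentiable_on_eq_differentiable_at by blast
    have th: "\<theta> \<noteq> 0" using assms(8) by auto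
    show "maurer_cartan F z v = diag_conj (sqrt a) (loop_form A \<alpha> B (\<theta> / of_real (sqrt a)) z v)"
      if z: "z \<in> D" for z v
    proof -
      have "maurer_cartan F z v = Omega Ft a \<theta> z v" using F z by blast
      also have "\<dots> = diag_conj (sqrt a) (loop_form A \<alpha> B (\<theta> / of_real (sqrt a)) z v)"
        by (rule Omega_eq_diag_conj[where Ft = Ft and z = z])
           (use z in \<open>simp_all add: W[OF assms(8)] th assms(7) offdiag_A offdiag_B diag_\<alpha>\<close>)
      finally show ?thesis .
    qed
  qed
  obtain z0 where z0: "z0 \<in> D" "hopf_differential N z0 \<noteq> 0"
    using assms(5) by (auto simp: non_conformal_def)
  have one: "(1::complex) \<in> sphere 0 1" by simp
  have "p z0 * q z0 \<noteq> 0"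
    using hopf_differential_frame[where Ft = Ft and N = N, OF assms(1,6) z0(1) conn W[OF one]] z0(2) by auto
  from conformal[OF simply_connected_imp_connected[OF assms(2)] z0(1) this] normal mean_curvature
  show "let f = (\<lambda>z. F z ** ctranspose (F z));
            Nf = (\<lambda>z. - (F z ** \<sigma>3 ** ctranspose (F z)));
            U = D - singular_set D f
        in \<exists>u. conformal_immersion_isolated_singularities D f u \<and>
               unit_normal_field U f Nf \<and>
               has_mean_curvature U f u Nf (\<lambda>z. (a\<^sup>2 + 1) / (a\<^sup>2 - 1))"
    unfolding Let_def f_def Nf_def by blast
qed

end
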